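(* Let $A$ be the Binary Two-Up Sequence $a(1),a(2),\ldots$. The sequence of types of the successive atoms of $A$ is the limit, as $k$ goes to infinity, of the words $S\,R(1)\,R(2)\cdots R(k)$, where $S = T\,U\,V\,W\,U$ and $$R(k) = (V W)^{2^{k-1}-1}\, X\, U\, (V W)^{2^{k-1}-1}\, X\, U \qquad (k\ge 1).$$ (That is, every atom of $A$ has one of the types $T,U,V,W,X$, and reading the types in order gives the infinite word $S\,R(1)\,R(2)\,R(3)\cdots$.) Furthermore, in $R(2)$ and beyond (i.e. in every $R(k)$ with $k\ge 2$), any pair of consecutive atoms $X\,U$ has the following "ancestor property". The last six terms of $A$ in this pair, of which the first two are the last two terms of the atom $X$ and the other four are the terms of the atom $U$, have the form $$a(p)=2^t+2^u,\quad a(p+1)=2^y,\quad a(p+2)=2^v+2^w,\quad a(p+3)=2^{y+1},\quad a(p+4)=2^{y+2},\quad a(p+5)=2^{y+3},$$ where $t<u$, $v<w$ and $u<w$; they have a common "ancestor" $a(m)=2^u+2^v$; and $2^u$ and $2^w$ can be added to form a new term.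
   Context: Two nonnegative integers are perpendicular if their binary expansions have no $1$ in the same bit-position. The Binary Two-Up Sequence $\{a(n)\}_{n\ge 0}$ is defined by: for each $n\ge 0$, $a(n)$ is the smallest nonnegative integer not among $a(0),\ldots,a(n-1)$ that is perpendicular to each of $a(\lceil n/2\rceil),\ldots,a(n-1)$, i.e. to each of the previous $\lfloor n/2\rfloor$ terms. It begins $0,1,2,4,8,3,16,32,64,12,128,\ldots$. The initial term $a(0)=0$ is ignored in the decomposition below. The weight of a nonnegative integer is the number of $1$'s in its binary expansion. Free $1$'s. When $n=2t$ is even, once $a(2t)$ has been determined the powers of $2$ in the binary expansion of $a(t)$ are "freed" (later terms need no longer be perpendicular to $a(t)$). Thus the free powers of $2$ after step $n$ are the $2^e$ which occur in the binary expansion of some $a(i)$, $1\le i\le n$, but of none of the terms $a(\lceil (n+1)/2\rceil),\ldots,a(n)$. Atoms. The sequence $a(1),a(2),\ldots$ is cut into consecutive blocks called atoms: an atom ends with the term $a(n)$ exactly when, after step $n$ (including the freeing, if $n$ is even), there are exactly two distinct free powers of $2$ and their sum is a number not among $a(1),\ldots,a(n)$. The code of an atom is obtained by going through its terms $a(i)$ in order and writing $Aw$, where $w$ is the weight of $a(i)$, followed, if $i=2t$ is even, by $Fw'$, where $w'$ is the weight of the freed term $a(t)$. The types of atoms are defined by their codes: $T = A1\,A1\,F1\,A1\,A1\,F1$; $U = A2\,A1\,F1\,A1\,A1\,F1$; $V = A2\,A1\,F2\,A1\,A1\,F1\,A2\,A1\,F1$; $W = A2\,A1\,F1\,A1\,A1\,F2\,A2\,A1\,F1$;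 $X = A2\,A1\,F2\,A1\,A1\,F1\,A2\,A1\,F2\,A2\,A1\,F1$. Thus atoms of types $T,U,V,W,X$ consist of $4,4,6,6,8$ terms of the sequence respectively. In the ancestor property, "ancestor" means an earlier term of the sequence ($m<p$), and "$2^u$ and $2^w$ can be added to form a new term" means that $2^u+2^w$ is not among the terms $a(1),\ldots,a(p+5)$. *)

theory Defs
  imports Complex_Main "HOL-Library.Infinite_Set"
begin

definition perpendicular :: "nat \<Rightarrow> nat \<Rightarrow> bool" where
  "perpendicular x y \<longleftrightarrow> (\<forall>e. \<not> (bit x e \<and> bit y e))"

definition weight :: "nat \<Rightarrow> nat" where
  "weight x = card {e. bit x e}"

text \<open>
  The Binary Two-Up Sequence; \<open>(n + 1) div 2\<close> is the ceiling of \<open>n / 2\<close>.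
  The minimum is always attained, see \<open>two_up_props\<close> below.
\<close>
function two_up :: "nat \<Rightarrow> nat" where
  "two_up n = (LEAST x. (\<forall>j\<in>{..<n}. x \<noteq> two_up j) \<and>
                        (\<forall>j\<in>{(n + 1) div 2..<n}. perpendicular x (two_up j)))"
  by pat_completeness auto
termination by (relation "measure id") auto

declare two_up.simps [simp del]

lemma two_up_props:
  shows two_up_new: "\<And>j. j < n \<Longrightarrow> two_up n \<noteq> two_up j"
    and two_up_perpendicular:
      "\<And>j. (n + 1) div 2 \<le> j \<Longrightarrow> j < n \<Longrightarrow> perpendicular (two_up n) (two_up j)"
proof -
  define P where "P = (\<lambda>x. (\<forall>j\<in>{..<n}. x \<noteq> two_up j) \<and>
                 (\<forall>j\<in>{(n + 1) div 2..<n}. perpendicular x (two_up j)))"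
  define N where "N = (\<Sum>j<n. two_up j)"
  have le: "two_up j < 2 ^ N" if "j < n" for j
  proof -
    have "two_up j \<le> N"
      unfolding N_def using that by (intro member_le_sum) auto
    also have "N < 2 ^ N" by simp
    finally show ?thesis .
  qed
  have "P (2 ^ N)"
    unfolding P_def
  proof (intro conjI ballI)
    fix j assume "j \<in> {..<n}"
    with le[of j] show "2 ^ N \<noteq> two_up j" by auto
  next
    fix j assume "j \<in> {(n + 1) div 2..<n}"
    with le[of j] have "\<not> bit (two_up j) N"
      by (simp add: bit_iff_odd)
    then show "perpendicular (2 ^ N) (two_up j)"
      by (auto simp: perpendicular_def bit_exp_iff)
  qed
  then have "P (LEAST x. P x)" by (rule LeastI)
  moreover have "two_up n = (LEAST x. P x)"
    unfolding P_def by (rule two_up.simps)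
  ultimately have "P (two_up n)" by simp
  note * = this[unfolded P_def]
  show "\<And>j. j < n \<Longrightarrow> two_up n \<noteq> two_up j" using * by blast
  show "\<And>j. (n + 1) div 2 \<le> j \<Longrightarrow> j < n \<Longrightarrow> perpendicular (two_up n) (two_up j)"
    using * by simp
qed

text \<open>
  The powers of 2 that are free after step \<open>n\<close>, including the freeing of
  \<open>two_up (n div 2)\<close> for even \<open>n\<close>; \<open>(n + 2) div 2\<close> is the ceiling of \<open>(n + 1) / 2\<close>.
\<close>
definition free_powers :: "nat \<Rightarrow> nat set" where
  "free_powers n =
     {2 ^ e | e. (\<exists>i\<in>{1..n}. bit (two_up i) e) \<and>
                 \<not> (\<exists>i\<in>{(n + 2) div 2..n}. bit (two_up i) e)}"

definition ends_atom :: "nat \<Rightarrow> bool" where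
  "ends_atom n \<longleftrightarrow>
     1 \<le> n \<and> card (free_powers n) = 2 \<and> \<Sum>(free_powers n) \<notin> two_up ` {1..n}"

text \<open>
  Atoms are numbered from 0. Atom \<open>j\<close> consists of the terms with indices
  \<open>atom_first j, \<dots>, atom_last j\<close>; this enumeration is meaningful for all \<open>j\<close> only if
  infinitely many indices end an atom.
\<close>
definition atom_last :: "nat \<Rightarrow> nat" where
  "atom_last j = enumerate {n. ends_atom n} j"

definition atom_first :: "nat \<Rightarrow> nat" where
  "atom_first j = (if j = 0 then 1 else atom_last (j - 1) + 1)"

datatype code_symbol = A nat | F nat

definition step_code :: "nat \<Rightarrow> code_symbol list" where
  "step_code i = A (weight (two_up i)) #
                 (if even i then [F (weight (two_up (i div 2)))] else [])"

definition atom_code :: "nat \<Rightarrow> code_symbol list" where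
  "atom_code j = concat (map step_code [atom_first j..<atom_last j + 1])"

datatype atom_type = T | U | V | W | X

primrec type_code :: "atom_type \<Rightarrow> code_symbol list" where
  "type_code T = [A 1, A 1, F 1, A 1, A 1, F 1]"
| "type_code U = [A 2, A 1, F 1, A 1, A 1, F 1]"
| "type_code V = [A 2, A 1, F 2, A 1, A 1, F 1, A 2, A 1, F 1]"
| "type_code W = [A 2, A 1, F 1, A 1, A 1, F 2, A 2, A 1, F 1]"
| "type_code X = [A 2, A 1, F 2, A 1, A 1, F 1, A 2, A 1, F 2, A 2, A 1, F 1]"

definition has_type :: "nat \<Rightarrow> atom_type \<Rightarrow> bool" where
  "has_type j \<tau> \<longleftrightarrow> atom_code j = type_code \<tau>"

definition S_word :: "atom_type list" where
  "S_word = [T, U, V, W, U]"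

definition R_word :: "nat \<Rightarrow> atom_type list" where
  "R_word k = concat (replicate (2 ^ (k - 1) - 1) [V, W]) @ [X, U] @
              concat (replicate (2 ^ (k - 1) - 1) [V, W]) @ [X, U]"

text \<open>The word \<open>S R(1) R(2) \<dots> R(k)\<close>.\<close>
definition SR_word :: "nat \<Rightarrow> atom_type list" where
  "SR_word k = S_word @ concat (map R_word [1..<k + 1])"

text \<open>Convergence of finite words to an infinite word, in the usual prefix topology.\<close>
definition word_limit :: "(nat \<Rightarrow> 'a list) \<Rightarrow> (nat \<Rightarrow> 'a) \<Rightarrow> bool" where
  "word_limit u w \<longleftrightarrow>
     (\<forall>n. \<forall>\<^sub>F k in sequentially. n \<le> length (u k) \<and> take n (u k) = map w [0..<n])"

text \<open>
  The ancestor property, for the six consecutive terms starting at index \<open>p\<close>.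
\<close>
definition ancestor_property :: "nat \<Rightarrow> bool" where
  "ancestor_property p \<longleftrightarrow>
     (\<exists>t u v w y.
        two_up p = 2 ^ t + 2 ^ u \<and>
        two_up (p + 1) = 2 ^ y \<and>
        two_up (p + 2) = 2 ^ v + 2 ^ w \<and>
        two_up (p + 3) = 2 ^ (y + 1) \<and>
        two_up (p + 4) = 2 ^ (y + 2) \<and>
        two_up (p + 5) = 2 ^ (y + 3) \<and>
        t < u \<and> v < w \<and> u < w \<and>
        (\<exists>m. 1 \<le> m \<and> m < p \<and> two_up m = 2 ^ u + 2 ^ v) \<and>
        2 ^ u + 2 ^ w \<notin> two_up ` {1..p + 5})"

end

theory Submission
  imports Defs
begin

text \<open>
  Call the indices \<open>12 q + 1, \<dots>, 12 q + 12\<close> block \<open>q\<close>. During block \<open>q\<close> exactly the terms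
  with indices \<open>6 q + 1, \<dots>, 6 q + 6\<close> are freed, that is, half of block \<open>q div 2\<close>, so the structure
  of the sequence reproduces itself under doubling. At any time at most three powers of 2 are free,
  every power of 2 below the next new one has been used, and hence the next term is a new power of 2
  or a sum of two free powers, the least one that has not been used. A sum involving a power that
  occurred so far only by itself is automatically new.

  In a half block the terms are a pair, three powers, a pair and a power; a half block reproduces
  a half block twice as far out, which yields the atoms \<open>V\<close> and \<open>W\<close>. The exceptional blocks arise
  when two pairs \<open>2\<^sup>t + 2\<^sup>u\<close> and \<open>2\<^sup>v + 2\<^sup>w\<close> are freed two steps apart: then \<open>2\<^sup>u\<close>, \<open>2\<^sup>v\<close>, \<open>2\<^sup>w\<close> are free
  at once, and since the ancestor \<open>2\<^sup>u + 2\<^sup>v\<close> and \<open>2\<^sup>v + 2\<^sup>w\<close> have been used, the next term is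
  \<open>2\<^sup>u + 2\<^sup>w\<close>, followed two steps later by \<open>2\<^sup>v + 2\<^sup>g\<close> with a fresh \<open>g\<close>. These two pairs have the
  ancestor \<open>2\<^sup>w + 2\<^sup>v\<close>, so the ancestor property propagates from block \<open>q\<close> to block \<open>2 q + 1\<close>, and the
  block is cut into the atoms \<open>X\<close> and \<open>U\<close>. The induction starts from the first 96 terms.
\<close>

subsection \<open>The greedy step\<close>

abbreviation bits :: "nat \<Rightarrow> nat set" where
  "bits x \<equiv> {e. bit x e}"

lemma bit_nat_exp_le: "2 ^ e \<le> x" if "bit x e" for x :: nat
proof (rule ccontr)
  assume "\<not> 2 ^ e \<le> x"
  then have "x div 2 ^ e = 0" by simp
  with that show False by (simp add: bit_iff_odd)
qed

lemma finite_bits [simp]: "finite (bits x)"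
proof -
  have "e \<le> x" if "bit x e" for e
    using less_le_trans[OF less_exp bit_nat_exp_le[OF that]] by simp
  then have "bits x \<subseteq> {..x}" by auto
  then show ?thesis by (rule finite_subset) simp
qed

lemma nat_less_exp_iff_bits: "x < 2 ^ m \<longleftrightarrow> bits x \<subseteq> {..<m}" for x :: nat
proof
  assume *: "x < 2 ^ m"
  have "e < m" if "bit x e" for e
  proof -
    have "(2 :: nat) ^ e < 2 ^ m" using bit_nat_exp_le[OF that] * by (rule le_less_trans)
    then show ?thesis by simp
  qed
  then show "bits x \<subseteq> {..<m}" by auto
next
  assume *: "bits x \<subseteq> {..<m}"
  have "take_bit m x = x"
    by (rule bit_eqI) (use * in \<open>auto simp: bit_take_bit_iff\<close>)
  then show "x < 2 ^ m" by (simp add: take_bit_nat_eq_self_iff)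
qed

lemma bits_exp [simp]: "bits (2 ^ e) = {e}"
  by (auto simp: bit_exp_iff)

text \<open>A power whose bit is absent from the other summands is added without carry, so the sum
  is a bitwise disjunction. With \<open>sum_exp_bits\<close> this identifies numbers with finite
  sets of exponents.\<close>

lemma bits_sum_exp: "finite S \<Longrightarrow> bits (\<Sum>e\<in>S. 2 ^ e) = S"
  including bit_operations_syntax
proof (induction S rule: finite_induct)
  case (insert e S)
  have "\<not> bit (\<Sum>e\<in>S. 2 ^ e :: nat) e"
    using insert by auto
  then have "2 ^ e AND (\<Sum>e\<in>S. 2 ^ e :: nat) = 0"
    by (intro bit_eqI) (auto simp: bit_and_iff bit_exp_iff)
  then have "2 ^ e + (\<Sum>e\<in>S. 2 ^ e) = 2 ^ e OR (\<Sum>e\<in>S. 2 ^ e :: nat)"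
    by (rule disjunctive_add_eq_or)
  with insert show ?case by (auto simp: bit_or_iff bit_exp_iff)
qed auto

lemma sum_exp_bits: "(\<Sum>e\<in>bits x. 2 ^ e) = x"
  using bits_sum_exp[OF finite_bits, of x] by (intro bit_eqI) blast

lemma bits_exp_add_exp [simp]: "c \<noteq> d \<Longrightarrow> bits (2 ^ c + 2 ^ d) = {c, d}"
  using bits_sum_exp[of "{c, d}"] by simp

lemma bit_exp_add_exp [simp]: "c \<noteq> d \<Longrightarrow> bit (2 ^ c + 2 ^ d :: nat) e \<longleftrightarrow> e = c \<or> e = d"
  using bits_exp_add_exp[of c d] by blast

lemma exp_add_exp_neq_exp [simp]:
  assumes "c \<noteq> d"
  shows "2 ^ c + 2 ^ d \<noteq> (2 :: nat) ^ e" "(2 :: nat) ^ e \<noteq> 2 ^ c + 2 ^ d"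
proof -
  have "{c, d} \<noteq> {e}" using assms by auto
  then have "bits (2 ^ c + 2 ^ d) \<noteq> bits (2 ^ e)"
    unfolding bits_exp bits_exp_add_exp[OF assms] .
  then show "2 ^ c + 2 ^ d \<noteq> (2 :: nat) ^ e" "(2 :: nat) ^ e \<noteq> 2 ^ c + 2 ^ d" by metis+
qed

lemma weight_exp [simp]: "weight (2 ^ e) = 1"
  unfolding weight_def by (subst bits_exp) simp

lemma weight_exp_add_exp [simp]: "c \<noteq> d \<Longrightarrow> weight (2 ^ c + 2 ^ d) = 2"
  unfolding weight_def by (subst bits_exp_add_exp) auto

section \<open>Perpendicularity windows, free exponents and new powers of 2\<close>

lemma two_up_0: "two_up 0 = 0"
  by (subst two_up.simps) (simp add: Least_eq_0)

lemma two_up_pos: "0 < n \<Longrightarrow> 0 < two_up n"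
  using two_up_new[of 0 n] two_up_0 by auto

lemma two_up_inj: "two_up i = two_up j \<longleftrightarrow> i = j"
  using two_up_new[of i j] two_up_new[of j i] by (metis nat_neq_iff)

text \<open>The two inequalities say symmetrically that the smaller index lies in the window to
  which the later term must be perpendicular.\<close>

lemma two_up_disjoint:
  assumes "i \<noteq> j" "i \<le> 2 * j" "j \<le> 2 * i" "bit (two_up i) e"
  shows "\<not> bit (two_up j) e"
proof (cases "i < j")
  case True
  then have "perpendicular (two_up j) (two_up i)"
    using assms by (intro two_up_perpendicular) auto
  with assms show ?thesis by (auto simp: perpendicular_def)
next
  case False
  then have "perpendicular (two_up i) (two_up j)"
    using assms by (intro two_up_perpendicular) auto
  with assms show ?thesis by (auto simp: perpendicular_def)
qed

text \<open>Exponents replace the powers of \<open>free_powers\<close>, so that using and freeing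
  become set operations with \<open>bits\<close>.\<close>

definition free_exps :: "nat \<Rightarrow> nat set" where
  "free_exps n = {e. (\<exists>i\<in>{1..n}. bit (two_up i) e) \<and>
                     \<not> (\<exists>i\<in>{(n + 2) div 2..n}. bit (two_up i) e)}"

lemma free_powers_eq: "free_powers n = (\<lambda>e. 2 ^ e) ` free_exps n"
  unfolding free_powers_def free_exps_def by blast

lemma ends_atom_iff:
  "ends_atom n \<longleftrightarrow> 1 \<le> n \<and> card (free_exps n) = 2 \<and>
     (\<Sum>e\<in>free_exps n. 2 ^ e) \<notin> two_up ` {1..n}"
proof -
  have "inj_on (\<lambda>e. 2 ^ e :: nat) (free_exps n)"
    by (auto intro: inj_onI)
  then show ?thesis
    unfolding ends_atom_def free_powers_eq
    by (simp add: card_image sum.reindex)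
qed

text \<open>The window loses its lowest index only when \<open>n\<close> is odd. The dropped term
  shares no bit with any term remaining in the window, hence all its exponents become free.\<close>

lemma free_exps_Suc:
  "free_exps (Suc n) = (free_exps n - bits (two_up (Suc n))) \<union>
     (if odd n then bits (two_up (Suc n div 2)) else {})"
proof (cases "odd n")
  case False
  then have "{(Suc n + 2) div 2..Suc n} = insert (Suc n) {(n + 2) div 2..n}"
    by (auto elim!: evenE)
  moreover have "{1..Suc n} = insert (Suc n) {1..n}" by auto
  ultimately show ?thesis using False unfolding free_exps_def by auto
next
  case True
  then obtain s where s: "n = 2 * s + 1" by (elim oddE)
  have w: "{(Suc n + 2) div 2..Suc n} = insert (Suc n) {s + 2..n}"
      "{(n + 2) div 2..n} = insert (s + 1) {s + 2..n}" "Suc n div 2 = s + 1"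
      "{1..Suc n} = insert (Suc n) {1..n}" "s + 1 \<in> {1..n}"
    using s by auto
  have d: "\<not> bit (two_up i) e" if "i \<in> insert (Suc n) {s + 2..n}" "bit (two_up (s + 1)) e" for i e
    using that s by (intro two_up_disjoint[of "s + 1"]) auto
  show ?thesis
    using True d w(5) unfolding free_exps_def w(1-4) by auto
qed

text \<open>New exponents enter the sequence only as powers of 2, and in their natural order
  (see \<open>tops_exists\<close>).\<close>
definition tops :: "nat \<Rightarrow> nat \<Rightarrow> bool" where
  "tops n m \<longleftrightarrow> (\<forall>e. (\<exists>i\<in>{1..n}. two_up i = 2 ^ e) \<longleftrightarrow> e < m) \<and> (\<forall>i\<le>n. two_up i < 2 ^ m)"

lemma tops_exp_used: "tops n m \<Longrightarrow> e < m \<Longrightarrow> 2 ^ e \<in> two_up ` {1..n}"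
  unfolding tops_def by (metis image_eqI)

lemma tops_less: "tops n m \<Longrightarrow> i \<le> n \<Longrightarrow> two_up i < 2 ^ m"
  unfolding tops_def by blast

lemma tops_free_exps_subset: "tops n m \<Longrightarrow> free_exps n \<subseteq> {..<m}"
proof
  fix e assume "tops n m" "e \<in> free_exps n"
  then obtain i where "i \<le> n" "bit (two_up i) e" unfolding free_exps_def by auto
  with tops_less[OF \<open>tops n m\<close>] show "e \<in> {..<m}" using nat_less_exp_iff_bits by blast
qed

text \<open>Every exponent below \<open>m\<close> has already occurred in the sequence, so absence
  from the current window is enough for it to be free.\<close>

lemma tops_subset_free_exps:
  assumes "tops n m" "x < 2 ^ m"
    and "\<And>j e. (n + 2) div 2 \<le> j \<Longrightarrow> j \<le> n \<Longrightarrow> bit x e \<Longrightarrow> \<not> bit (two_up j) e"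
  shows "bits x \<subseteq> free_exps n"
proof
  fix e assume e: "e \<in> bits x"
  with assms have "e < m" using nat_less_exp_iff_bits by blast
  with assms(1) obtain i where i: "i \<in> {1..n}" "two_up i = 2 ^ e"
    unfolding tops_def by blast
  then have "bit (two_up i) e" by (simp add: bit_exp_iff)
  with assms(3) e i(1) show "e \<in> free_exps n" unfolding free_exps_def by fastforce
qed

text \<open>The first two hypotheses make \<open>x\<close> a candidate for the greedy choice, which
  bounds the next term from above; the third supplies minimality.\<close>

lemma two_up_SucI:
  assumes "\<And>j. j \<le> n \<Longrightarrow> x \<noteq> two_up j"
    and "\<And>j e. (n + 2) div 2 \<le> j \<Longrightarrow> j \<le> n \<Longrightarrow> bit x e \<Longrightarrow> \<not> bit (two_up j) e"
    and "x \<le> two_up (Suc n)"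
  shows "two_up (Suc n) = x"
proof (rule antisym[OF _ assms(3)])
  show "two_up (Suc n) \<le> x"
    by (subst two_up.simps, rule Least_le)
      (use assms(1,2) in \<open>auto simp: perpendicular_def less_Suc_eq_le\<close>)
qed

text \<open>All earlier terms lie below \<open>2 ^ m\<close>, so this power is always a candidate
  and the next term never exceeds it.\<close>

lemma two_up_Suc_new_exp:
  assumes "tops n m" "2 ^ m \<le> two_up (Suc n)"
  shows "two_up (Suc n) = 2 ^ m"
proof (rule two_up_SucI[OF _ _ assms(2)])
  fix j assume j: "j \<le> n"
  show "2 ^ m \<noteq> two_up j" using tops_less[OF assms(1) j] by simp
  show "\<not> bit (two_up j) e" if "bit (2 ^ m :: nat) e" for e
    using tops_less[OF assms(1) j] nat_less_exp_iff_bits that by (auto simp: bit_exp_iff)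
qed

lemma two_up_Suc_bits:
  assumes "tops n m" "two_up (Suc n) < 2 ^ m"
  shows "bits (two_up (Suc n)) \<subseteq> free_exps n"
  using assms(1,2) by (rule tops_subset_free_exps) (rule two_up_disjoint[of "Suc n"], auto)

lemma tops_Suc_exp: "tops n m \<Longrightarrow> two_up (Suc n) = 2 ^ m \<Longrightarrow> tops (Suc n) (Suc m)"
proof -
  assume *: "tops n m" "two_up (Suc n) = 2 ^ m"
  have "{1..Suc n} = insert (Suc n) {1..n}" by auto
  then have "(\<exists>i\<in>{1..Suc n}. two_up i = 2 ^ e) \<longleftrightarrow> e < Suc m" for e
    using * by (auto simp: tops_def)
  moreover have "two_up i < 2 ^ Suc m" if "i \<le> Suc n" for i
  proof (cases "i = Suc n")
    case False
    with that have "two_up i < 2 ^ m" by (intro tops_less[OF *(1)]) simp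
    then show ?thesis by simp
  qed (use * in simp)
  ultimately show ?thesis unfolding tops_def by blast
qed

lemma tops_Suc_less: "tops n m \<Longrightarrow> two_up (Suc n) < 2 ^ m \<Longrightarrow> tops (Suc n) m"
proof -
  assume *: "tops n m" "two_up (Suc n) < 2 ^ m"
  have "{1..Suc n} = insert (Suc n) {1..n}" by auto
  then show ?thesis using * by (auto simp: tops_def le_Suc_eq)
qed

lemma tops_0: "tops 0 0"
  unfolding tops_def by (simp add: two_up_0)

lemma free_exps_0: "free_exps 0 = {}"
  unfolding free_exps_def by simp

text \<open>Each new term is either below \<open>2 ^ m\<close> or equal to it, so the invariant
  survives with \<open>m\<close> or \<open>Suc m\<close>.\<close>

lemma tops_exists: "\<exists>m. tops n m"
proof (induction n)
  case (Suc n)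
  then obtain m where m: "tops n m" by blast
  show ?case
    using tops_Suc_exp[OF m two_up_Suc_new_exp[OF m]] tops_Suc_less[OF m]
    by (metis linorder_not_less)
qed (use tops_0 in blast)

text \<open>Let \<open>m\<close> be the least exponent whose power is missing before index
  \<open>s\<close>. Since \<open>2 ^ e\<close> is new at \<open>s\<close>, \<open>m \<le> e\<close>,
  while all earlier terms are below \<open>2 ^ m\<close>.\<close>

lemma two_up_less_exp:
  assumes "two_up s = 2 ^ e" "i < s"
  shows "two_up i < 2 ^ e"
proof -
  obtain m where m: "tops (s - 1) m" using tops_exists by blast
  have "\<not> e < m"
  proof
    assume "e < m"
    from tops_exp_used[OF m this] obtain j where "j \<in> {1..s - 1}" "two_up j = 2 ^ e"
      by (metis imageE)
    with assms two_up_inj[of j s] show False by auto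
  qed
  then have "(2 :: nat) ^ m \<le> 2 ^ e" by simp
  moreover have "two_up i < 2 ^ m" using tops_less[OF m] assms by simp
  ultimately show ?thesis by (rule less_le_trans[rotated])
qed

text \<open>Terms before \<open>s\<close> are too small to contain \<open>e\<close>, and up to index
  \<open>2 * s\<close> the term at \<open>s\<close> stays in the window.\<close>

lemma not_bit_two_up:
  assumes "two_up s = 2 ^ e" "i \<le> 2 * s" "i \<noteq> s"
  shows "\<not> bit (two_up i) e"
proof (cases "i < s")
  case True
  then show ?thesis
    using two_up_less_exp[OF assms(1)] nat_less_exp_iff_bits by blast
next
  case False
  with assms two_up_disjoint[of s i e] show ?thesis by (auto simp: bit_exp_iff)
qed

text \<open>A term equal to this sum would contain \<open>e\<close>, hence be the power at index
  \<open>s\<close>. This is the main source of new sums in the induction.\<close>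

lemma fresh_pair:
  assumes "two_up s = 2 ^ e" "n \<le> 2 * s" "c \<noteq> e"
  shows "2 ^ c + 2 ^ e \<notin> two_up ` {1..n}"
proof
  assume "2 ^ c + 2 ^ e \<in> two_up ` {1..n}"
  then obtain i where i: "i \<in> {1..n}" "two_up i = 2 ^ c + 2 ^ e" by auto
  then have "bit (two_up i) e" using assms(3) by simp
  then have "i = s" using not_bit_two_up[OF assms(1), of i] assms(2) i(1) by auto
  with i assms show False by simp
qed

lemma unused_Suc:
  "x \<notin> two_up ` {1..n} \<Longrightarrow> two_up (Suc n) \<noteq> x \<Longrightarrow> x \<notin> two_up ` {1..Suc n}"
  by (auto simp: le_Suc_eq)

lemma two_up_Suc_free:
  assumes "tops n m" "S \<subseteq> free_exps n" "(\<Sum>e\<in>S. 2 ^ e) \<notin> two_up ` {1..n}" "S \<noteq> {}"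
    and least: "\<And>x. bits x \<subseteq> free_exps n \<Longrightarrow> x \<noteq> 0 \<Longrightarrow> x \<notin> two_up ` {1..n} \<Longrightarrow>
      (\<Sum>e\<in>S. 2 ^ e) \<le> x"
  shows "two_up (Suc n) = (\<Sum>e\<in>S. 2 ^ e)"
proof -
  have "S \<subseteq> {..<m}" using assms tops_free_exps_subset by blast
  moreover from this have fin: "finite S" using finite_subset by blast
  ultimately have lt: "(\<Sum>e\<in>S. 2 ^ e) < (2 :: nat) ^ m"
    using nat_less_exp_iff_bits bits_sum_exp by blast
  have nz: "(\<Sum>e\<in>S. 2 ^ e) \<noteq> (0 :: nat)" using assms(4) fin by auto
  show ?thesis
  proof (rule two_up_SucI)
    fix j assume "j \<le> n"
    then show "(\<Sum>e\<in>S. 2 ^ e) \<noteq> two_up j"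
      using assms(3) nz two_up_0 by (cases "j = 0") auto
  next
    fix j assume "(n + 2) div 2 \<le> j" "j \<le> n"
    then show "\<not> bit (two_up j) e" if "bit (\<Sum>e\<in>S. 2 ^ e :: nat) e" for e
      using assms(2) that bits_sum_exp[OF fin] unfolding free_exps_def by auto
  next
    show "(\<Sum>e\<in>S. 2 ^ e) \<le> two_up (Suc n)"
    proof (cases "two_up (Suc n) < 2 ^ m")
      case True
      have "two_up (Suc n) \<notin> two_up ` {1..n}" using two_up_inj by auto
      then show ?thesis
        using least two_up_Suc_bits[OF assms(1) True] two_up_pos[of "Suc n"] by simp
    qed (use lt in simp)
  qed
qed

section \<open>Greedy steps with at most three free powers\<close>

lemma single_step:
  assumes "tops n m"
    and used: "\<And>x. bits x \<subseteq> free_exps n \<Longrightarrow> x \<noteq> 0 \<Longrightarrow> x \<in> two_up ` {1..n}"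
  shows "two_up (Suc n) = 2 ^ m" "tops (Suc n) (Suc m)"
    "free_exps (Suc n) = free_exps n \<union> (if odd n then bits (two_up (Suc n div 2)) else {})"
proof -
  have "\<not> two_up (Suc n) < 2 ^ m"
  proof
    assume "two_up (Suc n) < 2 ^ m"
    then have "two_up (Suc n) \<in> two_up ` {1..n}"
      using used two_up_Suc_bits[OF assms(1)] two_up_pos[of "Suc n"] by blast
    then show False using two_up_inj by auto
  qed
  then show *: "two_up (Suc n) = 2 ^ m" using two_up_Suc_new_exp[OF assms(1)] by simp
  then show "tops (Suc n) (Suc m)" using tops_Suc_exp assms by blast
  have "m \<notin> free_exps n" using tops_free_exps_subset[OF assms(1)] by auto
  then show "free_exps (Suc n) = free_exps n \<union> (if odd n then bits (two_up (Suc n div 2)) else {})"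
    unfolding free_exps_Suc * by auto
qed

lemma tops_free_exp_used:
  "tops n m \<Longrightarrow> e \<in> free_exps n \<Longrightarrow> 2 ^ e \<in> two_up ` {1..n}"
  using tops_exp_used tops_free_exps_subset by blast

lemma bits_cases:
  assumes "bits x \<subseteq> S" "finite S"
  obtains R where "R \<subseteq> S" "x = (\<Sum>e\<in>R. 2 ^ e)"
  using assms sum_exp_bits[of x] by metis

lemma step_empty:
  assumes "tops n m" "free_exps n = {}"
  shows "two_up (Suc n) = 2 ^ m" "tops (Suc n) (Suc m)"
    "free_exps (Suc n) = (if odd n then bits (two_up (Suc n div 2)) else {})"
proof -
  have "x \<in> two_up ` {1..n}" if "bits x \<subseteq> free_exps n" "x \<noteq> 0" for x
    using that sum_exp_bits[of x] assms by auto
  from single_step[OF assms(1) this] show "two_up (Suc n) = 2 ^ m" "tops (Suc n) (Suc m)"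
    "free_exps (Suc n) = (if odd n then bits (two_up (Suc n div 2)) else {})"
    using assms(2) by simp_all
qed

lemma step_one:
  assumes "tops n m" "free_exps n = {d}"
  shows "two_up (Suc n) = 2 ^ m" "tops (Suc n) (Suc m)"
    "free_exps (Suc n) = {d} \<union> (if odd n then bits (two_up (Suc n div 2)) else {})"
proof -
  have "x \<in> two_up ` {1..n}" if x: "bits x \<subseteq> free_exps n" "x \<noteq> 0" for x
  proof -
    from x(1)[unfolded assms(2)] obtain R where "R \<subseteq> {d}" "x = (\<Sum>e\<in>R. 2 ^ e)"
      by (rule bits_cases) auto
    with x(2) have "x = 2 ^ d" by (auto simp: subset_singleton_iff)
    then show ?thesis using tops_free_exp_used[OF assms(1)] assms(2) by simp
  qed
  from single_step[OF assms(1) this] show "two_up (Suc n) = 2 ^ m" "tops (Suc n) (Suc m)"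
    "free_exps (Suc n) = {d} \<union> (if odd n then bits (two_up (Suc n div 2)) else {})"
    using assms(2) by simp_all
qed

lemma free_two_cases:
  assumes "tops n m" "free_exps n = {c, d}" "c \<noteq> d" "bits x \<subseteq> free_exps n" "x \<noteq> 0"
  shows "x \<in> two_up ` {1..n} \<or> x = 2 ^ c + 2 ^ d"
proof -
  from assms(4)[unfolded assms(2)] obtain R where "R \<subseteq> {c, d}" "x = (\<Sum>e\<in>R. 2 ^ e)"
    by (rule bits_cases) auto
  then have "x \<in> (\<lambda>R. \<Sum>e\<in>R. 2 ^ e) ` Pow {c, d}" by auto
  with assms(3,5) have "x \<in> {2 ^ c, 2 ^ d, 2 ^ c + 2 ^ d}"
    by (auto simp: Pow_insert)
  then show ?thesis using tops_free_exp_used[OF assms(1)] assms(2) by auto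
qed

lemma step_two_used:
  assumes "tops n m" "free_exps n = {c, d}" "c \<noteq> d" "2 ^ c + 2 ^ d \<in> two_up ` {1..n}"
  shows "two_up (Suc n) = 2 ^ m" "tops (Suc n) (Suc m)"
    "free_exps (Suc n) = {c, d} \<union> (if odd n then bits (two_up (Suc n div 2)) else {})"
proof -
  have "x \<in> two_up ` {1..n}" if "bits x \<subseteq> free_exps n" "x \<noteq> 0" for x
    using free_two_cases[OF assms(1-3) that] assms(4) by blast
  from single_step[OF assms(1) this] show "two_up (Suc n) = 2 ^ m" "tops (Suc n) (Suc m)"
    "free_exps (Suc n) = {c, d} \<union> (if odd n then bits (two_up (Suc n div 2)) else {})"
    using assms(2) by simp_all
qed

lemma pair_step:
  assumes "tops n m" "two_up (Suc n) = 2 ^ c + 2 ^ d" "c \<noteq> d" "{c, d} \<subseteq> free_exps n"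
  shows "tops (Suc n) m"
    "free_exps (Suc n) = (free_exps n - {c, d}) \<union>
       (if odd n then bits (two_up (Suc n div 2)) else {})"
proof -
  have "bits (two_up (Suc n)) \<subseteq> {..<m}"
    using assms tops_free_exps_subset[OF assms(1)] by auto
  then show "tops (Suc n) m" using nat_less_exp_iff_bits tops_Suc_less[OF assms(1)] by blast
  show "free_exps (Suc n) = (free_exps n - {c, d}) \<union>
      (if odd n then bits (two_up (Suc n div 2)) else {})"
    unfolding free_exps_Suc using assms(2,3) by simp
qed

lemma step_two_unused:
  assumes "tops n m" "free_exps n = {c, d}" "c \<noteq> d" "2 ^ c + 2 ^ d \<notin> two_up ` {1..n}"
  shows "two_up (Suc n) = 2 ^ c + 2 ^ d" "tops (Suc n) m"
    "free_exps (Suc n) = (if odd n then bits (two_up (Suc n div 2)) else {})"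
proof -
  have "two_up (Suc n) = (\<Sum>e\<in>{c, d}. 2 ^ e)"
    using assms(3,4) free_two_cases[OF assms(1-3)]
    by (intro two_up_Suc_free[OF assms(1)]) (auto simp: assms(2))
  then show *: "two_up (Suc n) = 2 ^ c + 2 ^ d" using assms(3) by simp
  from pair_step[OF assms(1) this assms(3)] show "tops (Suc n) m"
    "free_exps (Suc n) = (if odd n then bits (two_up (Suc n div 2)) else {})"
    using assms(2) by simp_all
qed

text \<open>The chosen pair is \<open>c\<close>, \<open>e\<close>, and \<open>d\<close> is left
  over. Each other pair is either used or larger, and the sum of all three is larger anyway. The
  names do not prescribe the order of the exponents, so one lemma serves every choice of
  pair.\<close>

lemma step_three:
  assumes "tops n m" "free_exps n = {c, d, e}" "c \<noteq> d" "c \<noteq> e" "d \<noteq> e"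
    and "2 ^ c + 2 ^ d \<in> two_up ` {1..n} \<or> e < d"
    and "2 ^ d + 2 ^ e \<in> two_up ` {1..n} \<or> c < d"
    and "2 ^ c + 2 ^ e \<notin> two_up ` {1..n}"
  shows "two_up (Suc n) = 2 ^ c + 2 ^ e" "tops (Suc n) m"
    "free_exps (Suc n) = {d} \<union> (if odd n then bits (two_up (Suc n div 2)) else {})"
proof -
  have min: "2 ^ c + 2 ^ e \<le> x"
    if x: "bits x \<subseteq> free_exps n" "x \<noteq> 0" "x \<notin> two_up ` {1..n}" for x
  proof -
    from x(1)[unfolded assms(2)] obtain R where "R \<subseteq> {c, d, e}" "x = (\<Sum>e\<in>R. 2 ^ e)"
      by (rule bits_cases) auto
    then have "x \<in> (\<lambda>R. \<Sum>e\<in>R. 2 ^ e) ` Pow {c, d, e}" by auto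
    with assms(3-5) x(2) have "x \<in> {2 ^ c, 2 ^ d, 2 ^ e, 2 ^ c + 2 ^ d, 2 ^ c + 2 ^ e, 2 ^ d + 2 ^ e,
        2 ^ c + 2 ^ d + 2 ^ e}"
      by (auto simp: Pow_insert)
    then have "x \<in> {2 ^ c + 2 ^ d, 2 ^ c + 2 ^ e, 2 ^ d + 2 ^ e, 2 ^ c + 2 ^ d + 2 ^ e}"
      using tops_free_exp_used[OF assms(1)] assms(2) x(3) by auto
    moreover have "2 ^ c + 2 ^ e \<le> (2 ^ c + 2 ^ d :: nat)" if "e < d"
      using that by simp
    moreover have "2 ^ c + 2 ^ e \<le> (2 ^ d + 2 ^ e :: nat)" if "c < d"
      using that by simp
    ultimately show ?thesis using assms(6,7) x(3) by auto
  qed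
  have "two_up (Suc n) = (\<Sum>e\<in>{c, e}. 2 ^ e)"
    using assms(4,8) min
    by (intro two_up_Suc_free[OF assms(1)]) (auto simp: assms(2))
  then show *: "two_up (Suc n) = 2 ^ c + 2 ^ e" using assms(4) by simp
  have "{c, d, e} - {c, e} = {d}" using assms(3,5) by auto
  with pair_step[OF assms(1) * assms(4)] show "tops (Suc n) m"
    "free_exps (Suc n) = {d} \<union> (if odd n then bits (two_up (Suc n div 2)) else {})"
    using assms(2) by simp_all
qed

lemma ends_atom_two:
  "free_exps n = {c, d} \<Longrightarrow> c \<noteq> d \<Longrightarrow> 1 \<le> n \<Longrightarrow>
    ends_atom n \<longleftrightarrow> 2 ^ c + 2 ^ d \<notin> two_up ` {1..n}"
  by (simp add: ends_atom_iff)

subsection \<open>The first 96 terms\<close>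

text \<open>Free exponents arrive sorted, so the pairs are tried by increasing sum.
  \<open>None\<close> marks situations beyond the step lemmas: both sums with the least exponent
  used, or more than three free exponents.\<close>

fun next_term :: "nat list list \<Rightarrow> nat \<Rightarrow> nat list \<Rightarrow> nat list option" where
  "next_term L m [] = Some [m]"
| "next_term L m [d] = Some [m]"
| "next_term L m [c, d] = Some (if [c, d] \<in> set L then [m] else [c, d])"
| "next_term L m [c, d, e] =
     (if [c, d] \<notin> set L then Some [c, d] else if [c, e] \<notin> set L then Some [c, e] else None)"
| "next_term L m _ = None"

text \<open>The components of a state are the terms found so far (as sorted lists of exponents), the
  least exponent that has not occurred, the sorted list of free exponents, and the indices that end
  an atom.\<close>
fun simulate :: "nat \<Rightarrow> (nat list list \<times> nat \<times> nat list \<times> nat list) option" where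
  "simulate 0 = Some ([], 0, [], [])"
| "simulate (Suc n) = (case simulate n of None \<Rightarrow> None | Some (L, m, G, E) \<Rightarrow>
     (case next_term L m G of None \<Rightarrow> None | Some S \<Rightarrow>
       (let L' = L @ [S];
            G' = sort (filter (\<lambda>e. e \<notin> set S) G @ (if odd n then L' ! (n div 2) else []))
        in if distinct G'
           then Some (L', if S = [m] then Suc m else m, G',
                      if length G' = 2 \<and> G' \<notin> set L' then E @ [Suc n] else E)
           else None)))"

section \<open>Soundness of the simulation\<close>

definition sound :: "nat \<Rightarrow> nat list list \<Rightarrow> nat \<Rightarrow> nat list \<Rightarrow> nat list \<Rightarrow> bool" where
  "sound n L m G E \<longleftrightarrow> length L = n \<and> (\<forall>l\<in>set L. sorted l \<and> distinct l) \<and>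
     (\<forall>i<n. bits (two_up (Suc i)) = set (L ! i)) \<and> tops n m \<and>
     sorted G \<and> distinct G \<and> free_exps n = set G \<and> set E = {i \<in> {1..n}. ends_atom i}"

text \<open>A finite set has only one sorted list without repetitions, so the question whether a sum
  has been used becomes an executable membership test.\<close>

lemma two_up_eq_pair_iff:
  assumes "length L = n" "\<forall>l\<in>set L. sorted l \<and> distinct l"
    "\<forall>i<n. bits (two_up (Suc i)) = set (L ! i)" "c < d"
  shows "2 ^ c + 2 ^ d \<in> two_up ` {1..n} \<longleftrightarrow> [c, d] \<in> set L"
proof
  assume "2 ^ c + 2 ^ d \<in> two_up ` {1..n}"
  then obtain k where "k \<in> {1..n}" "two_up k = 2 ^ c + 2 ^ d" by force
  then obtain i where i: "i < n" "two_up (Suc i) = 2 ^ c + 2 ^ d"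
    by (cases k) (auto simp: Suc_le_eq)
  then have "set (L ! i) = {c, d}"
    using assms(3,4) bits_exp_add_exp[of c d] by (metis less_irrefl)
  moreover have "L ! i \<in> set L" using i assms(1) by simp
  ultimately have "L ! i = [c, d]"
    using assms(2,4) by (intro sorted_distinct_set_unique) auto
  with \<open>L ! i \<in> set L\<close> show "[c, d] \<in> set L" by simp
next
  assume "[c, d] \<in> set L"
  then obtain i where i: "i < n" "L ! i = [c, d]"
    using assms(1) by (metis in_set_conv_nth)
  then have "bits (two_up (Suc i)) = {c, d}" using assms(3) by simp
  then have "two_up (Suc i) = 2 ^ c + 2 ^ d"
    using sum_exp_bits[of "two_up (Suc i)"] assms(4) by simp
  then show "2 ^ c + 2 ^ d \<in> two_up ` {1..n}"
    using i(1) by (intro image_eqI[of _ _ "Suc i"]) auto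
qed

lemma ends_atom_sound:
  assumes "length L = n" "\<forall>l\<in>set L. sorted l \<and> distinct l"
    "\<forall>i<n. bits (two_up (Suc i)) = set (L ! i)"
    "sorted G" "distinct G" "free_exps n = set G" "1 \<le> n"
  shows "ends_atom n \<longleftrightarrow> length G = 2 \<and> G \<notin> set L"
proof (cases "length G = 2")
  case True
  then obtain c d where G: "G = [c, d]"
    by (auto simp: numeral_2_eq_2 length_Suc_conv)
  with assms have "c < d" by auto
  with ends_atom_two[of n c d] two_up_eq_pair_iff[OF assms(1-3) this] assms G
  show ?thesis by simp
next
  case False
  then show ?thesis using assms by (simp add: ends_atom_iff distinct_card)
qed

lemma next_term_sound:
  assumes "sound n L m G E" "next_term L m G = Some S"
  shows "sorted S \<and> distinct S \<and> bits (two_up (Suc n)) = set S \<and>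
    tops (Suc n) (if S = [m] then Suc m else m)"
proof -
  note * = assms(1)[unfolded sound_def]
  have top: "tops n m" and sF: "sorted G" and dF: "distinct G" and fG: "free_exps n = set G"
    using * by auto
  have less: "e < m" if "e \<in> set G" for e
    using tops_free_exps_subset[OF top] fG that by auto
  have used: "2 ^ c + 2 ^ d \<in> two_up ` {1..n} \<longleftrightarrow> [c, d] \<in> set L" if "c < d" for c d
    using * that by (intro two_up_eq_pair_iff) auto
  consider "G = []" | d where "G = [d]" | c d where "G = [c, d]" | c d e where "G = [c, d, e]"
    using assms(2) by (cases "(L, m, G)" rule: next_term.cases) auto
  then show ?thesis
  proof cases
    case 1
    with assms(2) step_empty[OF top] fG show ?thesis by auto
  next
    case 2
    with assms(2) step_one[OF top] fG show ?thesis by auto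
  next
    case (3 c d)
    then have cd: "c < d" "c \<noteq> d" "free_exps n = {c, d}" "c < m" "d < m"
      using sF dF fG less by auto
    with 3 assms(2) step_two_used[OF top cd(3,2)] step_two_unused[OF top cd(3,2)] used[OF cd(1)]
    show ?thesis by (cases "[c, d] \<in> set L") auto
  next
    case (4 c d e)
    \<comment> \<open>The free set is listed in two orders because \<open>step_three\<close> leaves
      the middle exponent over: the first order yields the pair \<open>c\<close>, \<open>e\<close>,
      the second the pair \<open>c\<close>, \<open>d\<close>.\<close>
    then have cde: "c < d" "d < e" "c < e" "free_exps n = {c, d, e}" "free_exps n = {c, e, d}"
      "c < m" "d < m" "e < m"
      using sF dF fG less by auto
    show ?thesis
    proof (cases "[c, d] \<in> set L")
      case True
      with 4 assms(2) cde have "S = [c, e]" "[c, e] \<notin> set L" by (auto split: if_splits)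
      with step_three[OF top cde(4)] used cde True show ?thesis by auto
    next
      case False
      with 4 assms(2) cde have "S = [c, d]" by auto
      with step_three[OF top cde(5)] used cde False show ?thesis by auto
    qed
  qed
qed

lemma simulate_sound: "simulate n = Some (L, m, G, E) \<Longrightarrow> sound n L m G E"
proof (induction n arbitrary: L m G E)
  case 0
  then show ?case
    by (auto simp: sound_def tops_0 free_exps_0)
next
  case (Suc n)
  obtain L0 m0 G0 E0 where 0: "simulate n = Some (L0, m0, G0, E0)"
    using Suc.prems by (cases "simulate n") auto
  obtain S where S: "next_term L0 m0 G0 = Some S"
    using Suc.prems 0 by (cases "next_term L0 m0 G0") auto
  have res: "L = L0 @ [S]" "m = (if S = [m0] then Suc m0 else m0)"
    "G = sort (filter (\<lambda>e. e \<notin> set S) G0 @ (if odd n then L ! (n div 2) else []))"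
    "distinct (filter (\<lambda>e. e \<notin> set S) G0 @ (if odd n then L ! (n div 2) else []))"
    "E = (if length G = 2 \<and> G \<notin> set L then E0 @ [Suc n] else E0)"
    using Suc.prems 0 S by (auto simp: Let_def split: if_splits)
  note s0 = Suc.IH[OF 0]
  note sS = next_term_sound[OF s0 S]
  note s0 = s0[unfolded sound_def]
  have len: "length L = Suc n" and sor: "\<forall>l\<in>set L. sorted l \<and> distinct l"
    using s0 sS res(1) by auto
  have bit: "\<forall>i<Suc n. bits (two_up (Suc i)) = set (L ! i)"
    using s0 sS res(1) by (auto simp: nth_append less_Suc_eq)
  have G: "free_exps (Suc n) = set G"
  proof (cases "odd n")
    case True
    \<comment> \<open>List positions start at 0, so the freed term of index
      \<open>Suc (n div 2)\<close> stands at position \<open>n div 2\<close>.\<close>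
    then have "Suc n div 2 = Suc (n div 2)" "n div 2 < Suc n" by auto
    with True bit sS s0 show ?thesis unfolding free_exps_Suc res(3) by auto
  next
    case False
    with sS s0 show ?thesis unfolding free_exps_Suc res(3) by auto
  qed
  have "sorted G" "distinct G" using res(3,4) by simp_all
  then have "ends_atom (Suc n) \<longleftrightarrow> length G = 2 \<and> G \<notin> set L"
    using len sor bit G \<open>distinct G\<close> by (intro ends_atom_sound) auto
  then have "set E = {i \<in> {1..Suc n}. ends_atom i}"
    using s0 res(5) by (auto simp: le_Suc_eq)
  with len sor bit G \<open>sorted G\<close> \<open>distinct G\<close> res(2) sS show ?case
    unfolding sound_def by auto
qed

text \<open>The entry \<open>[0, 1]\<close> stands for the term 3. The 96 entries fill blocks 0 to
  7; blocks 4 to 7 are the base of the induction.\<close>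

definition table :: "nat list list" where
  "table =
   [[0], [1], [2], [3], [0, 1], [4], [5], [6], [2, 3], [7], [8], [9], [0, 4], [10], [1, 5],
    [11], [12], [13], [2, 6], [14], [3, 7], [15], [16], [17], [8, 9], [18], [19], [20], [0, 10],
    [21], [1, 4], [22], [5, 11], [23], [24], [25], [12, 13], [26], [27], [28], [2, 14], [29],
    [3, 6], [30], [7, 15], [31], [32], [33], [16, 17], [34], [35], [36], [8, 18], [37], [9, 19],
    [38], [39], [40], [0, 20], [41], [10, 21], [42], [43], [44], [1, 22], [45], [4, 5], [46],
    [11, 23], [47], [48], [49], [24, 25], [50], [51], [52], [12, 26], [53], [13, 27], [54],
    [55], [56], [2, 28], [57], [14, 29], [58], [59], [60], [3, 30], [61], [6, 7], [62],
    [15, 31], [63], [64], [65]]"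

definition end_table :: "nat list" where
  "end_table =
   [4, 8, 14, 20, 24, 32, 36, 44, 48, 54, 60, 68, 72, 78, 84, 92, 96]"

lemma simulate_table: "simulate 96 = Some (table, 66, [32, 33], end_table)"
  by code_simp

subsection \<open>The inductive step\<close>

definition single :: "nat \<Rightarrow> bool" where
  "single n \<longleftrightarrow> (\<exists>e. two_up n = 2 ^ e)"

definition pair :: "nat \<Rightarrow> bool" where
  "pair n \<longleftrightarrow> (\<exists>c d. c < d \<and> two_up n = 2 ^ c + 2 ^ d)"

lemma weight_single: "single n \<Longrightarrow> weight (two_up n) = 1"
  by (auto simp: single_def simp del: One_nat_def)

lemma weight_pair: "pair n \<Longrightarrow> weight (two_up n) = 2"
  by (auto simp: pair_def)

lemma pairI: "two_up n = 2 ^ c + 2 ^ d \<Longrightarrow> c \<noteq> d \<Longrightarrow> pair n"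
  unfolding pair_def by (metis add.commute linorder_neqE_nat)

text \<open>The parameter is the index just before the half block: \<open>12 * q\<close> and
  \<open>12 * q + 6\<close> give the halves of block \<open>q\<close>, and \<open>6 * q\<close>
  gives the half that is freed during block \<open>q\<close>.\<close>

definition half_block :: "nat \<Rightarrow> bool" where
  "half_block k \<longleftrightarrow> pair (k + 1) \<and> single (k + 2) \<and> single (k + 3) \<and> single (k + 4) \<and>
     pair (k + 5) \<and> single (k + 6)"

definition ends_at :: "nat \<Rightarrow> nat \<Rightarrow> bool" where
  "ends_at q s \<longleftrightarrow> (\<forall>r\<in>{1..12}. ends_atom (12 * q + r) \<longleftrightarrow> r = s \<or> r = 12)"

lemma ends_atom_obtain:
  assumes "ends_atom n"
  obtains x y where "x \<noteq> y" "free_exps n = {x, y}" "2 ^ x + 2 ^ y \<notin> two_up ` {1..n}"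
proof -
  from assms obtain x y where "x \<noteq> y" "free_exps n = {x, y}"
    unfolding ends_atom_iff card_2_iff by blast
  with assms that show ?thesis by (auto simp: ends_atom_iff)
qed

lemma not_ends_atom:
  "free_exps n = {} \<Longrightarrow> \<not> ends_atom n"
  "free_exps n = {c} \<Longrightarrow> \<not> ends_atom n"
  "c \<noteq> d \<Longrightarrow> c \<noteq> e \<Longrightarrow> d \<noteq> e \<Longrightarrow> free_exps n = {c, d, e} \<Longrightarrow> \<not> ends_atom n"
  by (simp_all add: ends_atom_iff)

text \<open>Together with the next two lemmas, this keeps indices in the form
  \<open>12 * q + r\<close> and decides which steps free a term.\<close>

lemma index_Suc:
  "Suc (12 * q) = 12 * q + 1" "Suc (12 * q + 1) = 12 * q + 2" "Suc (12 * q + 2) = 12 * q + 3"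
  "Suc (12 * q + 3) = 12 * q + 4" "Suc (12 * q + 4) = 12 * q + 5" "Suc (12 * q + 5) = 12 * q + 6"
  "Suc (12 * q + 6) = 12 * q + 7" "Suc (12 * q + 7) = 12 * q + 8" "Suc (12 * q + 8) = 12 * q + 9"
  "Suc (12 * q + 9) = 12 * q + 10" "Suc (12 * q + 10) = 12 * q + 11"
  "Suc (12 * q + 11) = 12 * q + 12"
  for q :: nat
  by simp_all

lemma index_half:
  "(12 * q + 2) div 2 = 6 * q + 1" "(12 * q + 4) div 2 = 6 * q + 2"
  "(12 * q + 6) div 2 = 6 * q + 3" "(12 * q + 8) div 2 = 6 * q + 4"
  "(12 * q + 10) div 2 = 6 * q + 5" "(12 * q + 12) div 2 = 6 * q + 6"
  for q :: nat
  by simp_all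

lemma parity_if:
  "(if odd (12 * q) then B else {}) = {}" "(if odd (12 * q + 1) then B else {}) = B"
  "(if odd (12 * q + 2) then B else {}) = {}" "(if odd (12 * q + 3) then B else {}) = B"
  "(if odd (12 * q + 4) then B else {}) = {}" "(if odd (12 * q + 5) then B else {}) = B"
  "(if odd (12 * q + 6) then B else {}) = {}" "(if odd (12 * q + 7) then B else {}) = B"
  "(if odd (12 * q + 8) then B else {}) = {}" "(if odd (12 * q + 9) then B else {}) = B"
  "(if odd (12 * q + 10) then B else {}) = {}" "(if odd (12 * q + 11) then B else {}) = B"
  for q :: nat
  by simp_all

lemmas index_simps = index_Suc index_half parity_if Un_empty_right

lemma used_index: "1 \<le> i \<Longrightarrow> i \<le> n \<Longrightarrow> two_up i = x \<Longrightarrow> x \<in> two_up ` {1..n}"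
  by auto

text \<open>The first six steps are common to normal and special blocks; only the freeing in the sixth
  step differs.\<close>
lemma first_steps:
  assumes q: "1 \<le> q" and ends: "ends_atom (12 * q)"
    and cd: "c < d" "two_up (6 * q + 1) = 2 ^ c + 2 ^ d" and e: "two_up (6 * q + 2) = 2 ^ e"
  obtains m where "tops (12 * q + 6) m" "free_exps (12 * q + 6) = {d} \<union> bits (two_up (6 * q + 3))"
    "half_block (12 * q)" "\<And>r. r \<in> {1..5} \<Longrightarrow> \<not> ends_atom (12 * q + r)"
proof -
  obtain m where m: "tops (12 * q) m" using tops_exists by blast
  obtain x y where xy: "x \<noteq> y" "free_exps (12 * q) = {x, y}"
      "2 ^ x + 2 ^ y \<notin> two_up ` {1..12 * q}"
    using ends by (rule ends_atom_obtain)
  have dist: "c \<noteq> d" "c \<noteq> e" "d \<noteq> e"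
    using two_up_disjoint[of "6 * q + 2" "6 * q + 1" e] q cd e by (auto simp: bit_exp_iff)
  note s1 = step_two_unused[OF m xy(2,1,3), unfolded index_simps]
  note s2 = step_empty[OF s1(2,3), unfolded index_simps]
  have f2: "free_exps (12 * q + 2) = {c, d}"
    using s2(3) cd dist by auto
  \<comment> \<open>The two exponents just freed formed the term at \<open>6 * q + 1\<close>, so
    their sum is used and two new powers follow.\<close>
  have u2: "2 ^ c + 2 ^ d \<in> two_up ` {1..n}" if "6 * q + 1 \<le> n" for n
    using cd(2) that by (intro used_index[of "6 * q + 1"]) auto
  have "2 ^ c + 2 ^ d \<in> two_up ` {1..12 * q + 2}" by (rule u2) simp
  note s3 = step_two_used[OF s2(2) f2 dist(1) this, unfolded index_simps]
  have "2 ^ c + 2 ^ d \<in> two_up ` {1..12 * q + 3}" by (rule u2) simp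
  note s4 = step_two_used[OF s3(2,3) dist(1) this, unfolded index_simps]
  have f4: "free_exps (12 * q + 4) = {c, d, e}"
    using s4(3) e by (auto simp: bit_exp_iff)
  have u4: "2 ^ c + 2 ^ d \<in> two_up ` {1..12 * q + 4}" by (rule u2) simp
  \<comment> \<open>The range of \<open>fresh_pair\<close> ends exactly at
    \<open>2 * (6 * q + 2)\<close>. As \<open>c < d\<close>, joining \<open>c\<close> to
    \<open>e\<close> beats joining \<open>d\<close>, and \<open>d\<close> stays free.\<close>
  have n4: "2 ^ c + 2 ^ e \<notin> two_up ` {1..12 * q + 4}"
    using e dist by (intro fresh_pair[of "6 * q + 2"]) auto
  note s5 = step_three[OF s4(2) f4 dist disjI1[OF u4] disjI2[OF cd(1)] n4, unfolded index_simps]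
  note s6 = step_one[OF s5(2,3), unfolded index_simps]
  show ?thesis
  proof (rule that[OF s6(2,3)])
    show "half_block (12 * q)"
      using s1(1) s2(1) s3(1) s4(1) s5(1) s6(1) xy(1) dist(2)
      unfolding half_block_def single_def by (blast intro: pairI)
    have "\<not> ends_atom (12 * q + 2)"
      using ends_atom_two[OF f2 dist(1)] u2[of "12 * q + 2"] by simp
    moreover have "\<not> ends_atom (12 * q + 3)"
      using ends_atom_two[OF s3(3) dist(1)] u2[of "12 * q + 3"] by simp
    moreover note not_ends_atom(1)[OF s1(3)] not_ends_atom(2)[OF s5(3)]
      not_ends_atom(3)[OF dist f4]
    moreover fix r :: nat assume "r \<in> {1..5}"
    then have "r = 1 \<or> r = 2 \<or> r = 3 \<or> r = 4 \<or> r = 5" by auto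
    ultimately show "\<not> ends_atom (12 * q + r)" by blast
  qed
qed

lemma ends_atI:
  assumes "\<And>r. r \<in> {1..5} \<Longrightarrow> \<not> ends_atom (12 * q + r)"
    and "\<And>r. r \<in> {6, 7, 8, 9, 10, 11, 12} \<Longrightarrow> ends_atom (12 * q + r) \<longleftrightarrow> r = s \<or> r = 12" "6 \<le> s"
  shows "ends_at q s"
  unfolding ends_at_def
proof
  fix r :: nat assume "r \<in> {1..12}"
  then have "r \<in> {1..5} \<or> r \<in> {6, 7, 8, 9, 10, 11, 12}" by auto
  then show "ends_atom (12 * q + r) \<longleftrightarrow> r = s \<or> r = 12"
    using assms by auto
qed

text \<open>The leftover \<open>d\<close> joins the single \<open>f\<close>, which ends the first
  atom and opens the second half. Later \<open>c'\<close> joins \<open>g\<close>, and the leftover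
  \<open>d'\<close> with the single \<open>h\<close> will open the next block.\<close>

lemma normal_block_step:
  assumes q: "1 \<le> q" and ends: "ends_atom (12 * q)" and half: "half_block (6 * q)"
  shows "half_block (12 * q) \<and> half_block (12 * q + 6) \<and> ends_at q 6"
proof -
  from half obtain c d e f g c' d' h where
    cd: "c < d" "two_up (6 * q + 1) = 2 ^ c + 2 ^ d" and e: "two_up (6 * q + 2) = 2 ^ e" and
    f: "two_up (6 * q + 3) = 2 ^ f" and g: "two_up (6 * q + 4) = 2 ^ g" and
    cd': "c' < d'" "two_up (6 * q + 5) = 2 ^ c' + 2 ^ d'" and h: "two_up (6 * q + 6) = 2 ^ h"
    unfolding half_block_def single_def pair_def by blast
  obtain m where m: "tops (12 * q + 6) m"
      "free_exps (12 * q + 6) = {d} \<union> bits (two_up (6 * q + 3))" and first: "half_block (12 * q)"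
      "\<And>r. r \<in> {1..5} \<Longrightarrow> \<not> ends_atom (12 * q + r)"
    using first_steps[OF q ends cd e] by blast
  have df: "d \<noteq> f" "d' \<noteq> h"
    using two_up_disjoint[of "6 * q + 3" "6 * q + 1" f] two_up_disjoint[of "6 * q + 6" "6 * q + 5" h]
      q cd f cd' h by (auto simp: bit_exp_iff)
  have dist: "c' \<noteq> d'" "c' \<noteq> g" "d' \<noteq> g"
    using two_up_disjoint[of "6 * q + 4" "6 * q + 5" g] q cd' g by (auto simp: bit_exp_iff)
  have f6: "free_exps (12 * q + 6) = {d, f}" using m(2) f by (auto simp: bit_exp_iff)
  have n6: "2 ^ d + 2 ^ f \<notin> two_up ` {1..12 * q + 6}"
    using f df by (intro fresh_pair[of "6 * q + 3"]) auto
  note s7 = step_two_unused[OF m(1) f6 df(1) n6, unfolded index_simps]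
  note s8 = step_empty[OF s7(2,3), unfolded index_simps]
  have f8: "free_exps (12 * q + 8) = {g}" using s8(3) g by simp
  note s9 = step_one[OF s8(2) f8, unfolded index_simps]
  note s10 = step_one[OF s9(2,3), unfolded index_simps]
  have f10: "free_exps (12 * q + 10) = {c', d', g}"
    using s10(3) cd' by auto
  have u10: "2 ^ c' + 2 ^ d' \<in> two_up ` {1..12 * q + 10}"
    using cd'(2) by (intro used_index[of "6 * q + 5"]) auto
  \<comment> \<open>Freshness of \<open>g\<close> reaches only to \<open>12 * q + 8\<close>; the
    next two terms are single powers and hence differ from the sum.\<close>
  have "2 ^ c' + 2 ^ g \<notin> two_up ` {1..12 * q + 8}"
    using g dist by (intro fresh_pair[of "6 * q + 4"]) auto
  from unused_Suc[OF this, unfolded index_simps] s9(1) dist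
  have "2 ^ c' + 2 ^ g \<notin> two_up ` {1..12 * q + 9}" by (simp del: power_Suc)
  from unused_Suc[OF this, unfolded index_simps] s10(1) dist
  have n10: "2 ^ c' + 2 ^ g \<notin> two_up ` {1..12 * q + 10}" by (simp del: power_Suc)
  note s11 = step_three[OF s10(2) f10 dist disjI1[OF u10] disjI2[OF cd'(1)] n10,
      unfolded index_simps]
  note s12 = step_one[OF s11(2,3), unfolded index_simps]
  have f12: "free_exps (12 * q + 12) = {d', h}" using s12(3) h by (auto simp: bit_exp_iff)
  have n12: "2 ^ d' + 2 ^ h \<notin> two_up ` {1..12 * q + 12}"
    using h df by (intro fresh_pair[of "6 * q + 6"]) auto
  have "12 * q + 6 + 1 = 12 * q + 7" "12 * q + 6 + 2 = 12 * q + 8" "12 * q + 6 + 3 = 12 * q + 9"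
    "12 * q + 6 + 4 = 12 * q + 10" "12 * q + 6 + 5 = 12 * q + 11" "12 * q + 6 + 6 = 12 * q + 12"
    by simp_all
  then have "half_block (12 * q + 6)"
    using s7(1) s8(1) s9(1) s10(1) s11(1) s12(1) df dist(2)
    unfolding half_block_def single_def by (metis pairI)
  moreover have "ends_at q 6"
  proof (rule ends_atI[OF first(2)])
    have "ends_atom (12 * q + 6)" "ends_atom (12 * q + 12)"
      using ends_atom_two[OF f6 df(1)] n6 ends_atom_two[OF f12 df(2)] n12 by simp_all
    then show "ends_atom (12 * q + r) \<longleftrightarrow> r = 6 \<or> r = 12" if "r \<in> {6, 7, 8, 9, 10, 11, 12}" for r
      using that not_ends_atom(1)[OF s7(3)] not_ends_atom(2)[OF f8] not_ends_atom(2)[OF s9(3)]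
        not_ends_atom(3)[OF dist f10] not_ends_atom(2)[OF s11(3)] by auto
  qed auto
  ultimately show ?thesis using first(1) by blast
qed

text \<open>The roles \<open>t\<close>, \<open>u\<close>, \<open>v\<close>, \<open>w\<close> pass to
  \<open>u\<close>, \<open>w\<close>, \<open>v\<close>, \<open>g\<close>, and the pair at
  \<open>6 * q + 3\<close> becomes the new ancestor. The first atom ends two terms later than in a
  normal block, once \<open>v\<close> and \<open>g\<close> are free.\<close>

lemma special_block_step:
  assumes q: "1 \<le> q" and ends: "ends_atom (12 * q)" and anc: "ancestor_property (6 * q + 1)"
  shows "half_block (12 * q) \<and> ancestor_property (12 * q + 7) \<and> ends_at q 8"
proof -
  have "6 * q + 1 + 1 = 6 * q + 2" "6 * q + 1 + 2 = 6 * q + 3" "6 * q + 1 + 3 = 6 * q + 4"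
    "6 * q + 1 + 4 = 6 * q + 5" "6 * q + 1 + 5 = 6 * q + 6" by simp_all
  note anc = anc[unfolded ancestor_property_def this]
  from anc obtain t u v w e g h k i where
    tu: "t < u" "two_up (6 * q + 1) = 2 ^ t + 2 ^ u" and e: "two_up (6 * q + 2) = 2 ^ e" and
    vw: "v < w" "two_up (6 * q + 3) = 2 ^ v + 2 ^ w" and g: "two_up (6 * q + 4) = 2 ^ g" and
    h: "two_up (6 * q + 5) = 2 ^ h" and k: "two_up (6 * q + 6) = 2 ^ k" and
    uw: "u < w" and i: "1 \<le> i" "i < 6 * q + 1" "two_up i = 2 ^ u + 2 ^ v" and
    new: "2 ^ u + 2 ^ w \<notin> two_up ` {1..6 * q + 6}"
    by blast
  obtain m where m: "tops (12 * q + 6) m"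
      "free_exps (12 * q + 6) = {u} \<union> bits (two_up (6 * q + 3))" and first: "half_block (12 * q)"
      "\<And>r. r \<in> {1..5} \<Longrightarrow> \<not> ends_atom (12 * q + r)"
    using first_steps[OF q ends tu e] by blast
  have "u \<noteq> v"
    using two_up_disjoint[of "6 * q + 1" "6 * q + 3" u] q tu vw by (auto simp: bit_exp_iff)
  with uw vw have dist: "u \<noteq> v" "u \<noteq> w" "v \<noteq> w" by auto
  \<comment> \<open>The pair precedes the first occurrence of \<open>2 ^ g\<close>, so both its
    exponents are below \<open>g\<close>.\<close>
  have "2 ^ v + 2 ^ w < (2 :: nat) ^ g"
    using two_up_less_exp[OF g, of "6 * q + 3"] vw(2) by simp
  then have "(2 :: nat) ^ v < 2 ^ g" "(2 :: nat) ^ w < 2 ^ g"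
    by (metis add_lessD1, metis add.commute add_lessD1)
  then have vg: "v < g" "w < g" by simp_all
  have hk: "h \<noteq> k" using h k two_up_inj[of "6 * q + 5" "6 * q + 6"] by auto
  have f6: "free_exps (12 * q + 6) = {u, v, w}" using m(2) vw by auto
  have a6: "2 ^ u + 2 ^ v \<in> two_up ` {1..12 * q + 6}"
    using i by (intro used_index[of i]) auto
  have b6: "2 ^ v + 2 ^ w \<in> two_up ` {1..12 * q + 6}"
    using vw by (intro used_index[of "6 * q + 3"]) auto
  \<comment> \<open>The hypothesis covers indices up to \<open>6 * q + 6\<close>; later terms up to
    \<open>12 * q + 6\<close> still have the term at \<open>6 * q + 3\<close>, which contains
    \<open>w\<close>, in their window.\<close>
  have n6: "2 ^ u + 2 ^ w \<notin> two_up ` {1..12 * q + 6}"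
  proof
    assume "2 ^ u + 2 ^ w \<in> two_up ` {1..12 * q + 6}"
    then obtain j where j: "2 ^ u + 2 ^ w = two_up j" "j \<in> {1..12 * q + 6}" by (rule imageE)
    have "\<not> j \<le> 6 * q + 6"
    proof
      assume "j \<le> 6 * q + 6"
      then have "j \<in> {1..6 * q + 6}" using j(2) by simp
      then show False using new unfolding j(1) by (rule notE[OF _ imageI, rotated])
    qed
    moreover have "bit (two_up j) w" "bit (two_up (6 * q + 3)) w"
      using j(1)[symmetric] vw dist by simp_all
    ultimately show False using two_up_disjoint[of "6 * q + 3" j w] j(2) by simp
  qed
  note s7 = step_three[OF m(1) f6 dist disjI1[OF a6] disjI1[OF b6] n6, unfolded index_simps]
  note s8 = step_one[OF s7(2,3), unfolded index_simps]
  have f8: "free_exps (12 * q + 8) = {v, g}" using s8(3) g by (auto simp: bit_exp_iff)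
  have n8: "2 ^ v + 2 ^ g \<notin> two_up ` {1..12 * q + 8}"
    using g vg by (intro fresh_pair[of "6 * q + 4"]) auto
  have "v \<noteq> g" using vg by simp
  note s9 = step_two_unused[OF s8(2) f8 this n8, unfolded index_simps]
  note s10 = step_empty[OF s9(2,3), unfolded index_simps]
  have f10: "free_exps (12 * q + 10) = {h}" using s10(3) h by simp
  note s11 = step_one[OF s10(2) f10, unfolded index_simps]
  note s12 = step_one[OF s11(2,3), unfolded index_simps]
  have f12: "free_exps (12 * q + 12) = {h, k}" using s12(3) k by (auto simp: bit_exp_iff)
  have n12: "2 ^ h + 2 ^ k \<notin> two_up ` {1..12 * q + 12}"
    using k hk by (intro fresh_pair[of "6 * q + 6"]) auto
  have "2 ^ w + 2 ^ g \<notin> two_up ` {1..12 * q + 8}"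
    using g vg by (intro fresh_pair[of "6 * q + 4"]) auto
  from unused_Suc[OF this, unfolded index_simps] s9(1) dist
  have "2 ^ w + 2 ^ g \<notin> two_up ` {1..12 * q + 9}" by (simp del: power_Suc)
  from unused_Suc[OF this, unfolded index_simps] s10(1) vg
  have "2 ^ w + 2 ^ g \<notin> two_up ` {1..12 * q + 10}" by (simp del: power_Suc)
  from unused_Suc[OF this, unfolded index_simps] s11(1) vg
  have "2 ^ w + 2 ^ g \<notin> two_up ` {1..12 * q + 11}" by (simp del: power_Suc)
  from unused_Suc[OF this, unfolded index_simps] s12(1) vg
  have new': "2 ^ w + 2 ^ g \<notin> two_up ` {1..12 * q + 12}" by (simp del: power_Suc)
  have idx: "12 * q + 7 + 1 = 12 * q + 8" "12 * q + 7 + 2 = 12 * q + 9"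
    "12 * q + 7 + 3 = 12 * q + 10" "12 * q + 7 + 4 = 12 * q + 11" "12 * q + 7 + 5 = 12 * q + 12"
    by simp_all
  have "ancestor_property (12 * q + 7)"
    unfolding ancestor_property_def idx
  proof (intro exI conjI)
    show "two_up (12 * q + 7) = 2 ^ u + 2 ^ w" "two_up (12 * q + 8) = 2 ^ m"
      "two_up (12 * q + 9) = 2 ^ v + 2 ^ g" using s7(1) s8(1) s9(1) by auto
    show "two_up (12 * q + 10) = 2 ^ (m + 1)" using s10(1) by simp
    show "two_up (12 * q + 11) = 2 ^ (m + 2)" using s11(1) by simp
    show "two_up (12 * q + 12) = 2 ^ (m + 3)" using s12(1) by (simp add: numeral_3_eq_3)
    show "u < w" "v < g" "w < g" using uw vg by auto
    show "1 \<le> 6 * q + 3" "6 * q + 3 < 12 * q + 7" by auto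
    show "two_up (6 * q + 3) = 2 ^ w + 2 ^ v" using vw(2) by simp
    show "2 ^ w + 2 ^ g \<notin> two_up ` {1..12 * q + 12}" by (rule new')
  qed
  moreover have "ends_at q 8"
  proof (rule ends_atI[OF first(2)])
    have "ends_atom (12 * q + 8)" "ends_atom (12 * q + 12)"
      using ends_atom_two[OF f8] vg n8 ends_atom_two[OF f12 hk] n12 by simp_all
    then show "ends_atom (12 * q + r) \<longleftrightarrow> r = 8 \<or> r = 12" if "r \<in> {6, 7, 8, 9, 10, 11, 12}" for r
      using that not_ends_atom(3)[OF dist f6] not_ends_atom(2)[OF s7(3)] not_ends_atom(1)[OF s9(3)]
        not_ends_atom(2)[OF f10] not_ends_atom(2)[OF s11(3)] by auto
  qed auto
  ultimately show ?thesis using first(1) by blast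
qed

section \<open>Facts read off the table for the base blocks\<close>

lemma sound_table: "sound 96 table 66 [32, 33] end_table"
  using simulate_table by (rule simulate_sound)

lemma sum_list_table:
  assumes "n \<in> {1..96}"
  shows "two_up n = (\<Sum>e\<leftarrow>table ! (n - 1). 2 ^ e)"
proof -
  from assms obtain i where i: "n = Suc i" "i < 96" by (cases n) auto
  have *: "bits (two_up n) = set (table ! (n - 1))" "distinct (table ! (n - 1))"
    using sound_table i unfolding sound_def by auto
  from sum_exp_bits[of "two_up n", unfolded *] *(2) show ?thesis
    by (simp add: sum.distinct_set_conv_list)
qed

lemma weight_table: "n \<in> {1..96} \<Longrightarrow> weight (two_up n) = length (table ! (n - 1))"
  using sound_table unfolding sound_def weight_def by (cases n) (auto simp: distinct_card)

lemma single_table: "n \<in> {1..96} \<Longrightarrow> length (table ! (n - 1)) = 1 \<Longrightarrow> single n"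
  unfolding single_def by (subst sum_list_table) (auto simp: length_Suc_conv)

lemma pair_table:
  assumes "n \<in> {1..96}" "length (table ! (n - 1)) = 2"
  shows "pair n"
proof -
  from assms(2) obtain c d where cd: "table ! (n - 1) = [c, d]"
    by (auto simp: numeral_2_eq_2 length_Suc_conv)
  have "table ! (n - 1) \<in> set table"
    using sound_table assms(1) unfolding sound_def by (intro nth_mem) auto
  then have "distinct [c, d]" using sound_table cd unfolding sound_def by metis
  then show ?thesis
    using sum_list_table[OF assms(1)] cd by (intro pairI[of _ c d]) auto
qed

lemma ends_atom_table: "n \<in> {1..96} \<Longrightarrow> ends_atom n \<longleftrightarrow> n \<in> set end_table"
  using sound_table unfolding sound_def by auto

lemma pair_unused_table:
  assumes "c < d" "[c, d] \<notin> set table" "n \<le> 96"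
  shows "2 ^ c + 2 ^ d \<notin> two_up ` {1..n}"
proof -
  have "2 ^ c + 2 ^ d \<notin> two_up ` {1..96}"
    using sound_table assms(1,2) unfolding sound_def by (subst two_up_eq_pair_iff) auto
  with assms(3) show ?thesis by auto
qed

text \<open>These are the normal halves of blocks 4 to 7; the second halves of blocks 5 and 7 have
  the ancestor property instead.\<close>

lemma half_block_table: "k \<in> {48, 54, 60, 72, 78, 84} \<Longrightarrow> half_block k"
  unfolding half_block_def
  by (auto intro!: single_table pair_table simp: table_def)

lemma ancestor_property_67: "ancestor_property 67"
  unfolding ancestor_property_def
proof (intro exI conjI)
  show "two_up 67 = 2 ^ 4 + 2 ^ 5" "two_up (67 + 1) = 2 ^ 46" "two_up (67 + 2) = 2 ^ 11 + 2 ^ 23"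
    "two_up (67 + 3) = 2 ^ (46 + 1)" "two_up (67 + 4) = 2 ^ (46 + 2)"
    "two_up (67 + 5) = 2 ^ (46 + 3)" "two_up 33 = 2 ^ 5 + 2 ^ 11"
    by (simp_all add: sum_list_table table_def)
  show "2 ^ 5 + 2 ^ 23 \<notin> two_up ` {1..67 + 5}"
    by (rule pair_unused_table) (simp_all add: table_def)
qed simp_all

lemma ancestor_property_91: "ancestor_property 91"
  unfolding ancestor_property_def
proof (intro exI conjI)
  show "two_up 91 = 2 ^ 6 + 2 ^ 7" "two_up (91 + 1) = 2 ^ 62" "two_up (91 + 2) = 2 ^ 15 + 2 ^ 31"
    "two_up (91 + 3) = 2 ^ (62 + 1)" "two_up (91 + 4) = 2 ^ (62 + 2)"
    "two_up (91 + 5) = 2 ^ (62 + 3)" "two_up 45 = 2 ^ 7 + 2 ^ 15"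
    by (simp_all add: sum_list_table table_def)
  show "2 ^ 7 + 2 ^ 31 \<notin> two_up ` {1..91 + 5}"
    by (rule pair_unused_table) (simp_all add: table_def)
qed simp_all

section \<open>Special blocks and the block invariant\<close>

text \<open>Special blocks are those cut into \<open>X\<close> and \<open>U\<close>. Blocks 2 and 3,
  which make up R(1), start the recursion; from 4 on, a special block must reproduce the second half
  of a special block.\<close>

fun special :: "nat \<Rightarrow> bool" where
  "special q \<longleftrightarrow> (if q < 4 then q = 2 \<or> q = 3 else odd q \<and> special (q div 2))"

declare special.simps [simp del]

lemma special_small:
  "special 2" "special 3" "\<not> special 4" "special 5" "\<not> special 6" "special 7"
  by (simp_all add: special.simps)

lemma special_iff:
  "4 \<le> q \<Longrightarrow> special q \<longleftrightarrow> odd q \<and> special (q div 2)"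
  by (subst special.simps) auto

text \<open>Passing from \<open>q\<close> to \<open>2 * q + 1\<close> doubles \<open>q + 1\<close>,
  starting from the values 3 and 4.\<close>

lemma special_range:
  "2 * 2 ^ n \<le> q \<Longrightarrow> q < 4 * 2 ^ n \<Longrightarrow> special q \<longleftrightarrow> q + 1 = 3 * 2 ^ n \<or> q + 1 = 4 * 2 ^ n"
proof (induction n arbitrary: q)
  case 0
  then have "q = 2 \<or> q = 3" by auto
  then show ?case using special_small by auto
next
  case (Suc n)
  have "(1 :: nat) \<le> 2 ^ n" by simp
  with Suc.prems have "4 \<le> q" unfolding power_Suc by linarith
  then have "special q \<longleftrightarrow> odd q \<and> special (q div 2)" by (rule special_iff)
  also have "special (q div 2) \<longleftrightarrow> q div 2 + 1 = 3 * 2 ^ n \<or> q div 2 + 1 = 4 * 2 ^ n"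
    using Suc.prems by (intro Suc.IH) auto
  also have "odd q \<and> (q div 2 + 1 = 3 * 2 ^ n \<or> q div 2 + 1 = 4 * 2 ^ n) \<longleftrightarrow>
      q + 1 = 3 * 2 ^ Suc n \<or> q + 1 = 4 * 2 ^ Suc n"
    by (auto elim!: oddE) presburger+
  finally show ?case .
qed

definition block :: "nat \<Rightarrow> bool" where
  "block q \<longleftrightarrow> half_block (12 * q) \<and>
     (if special q then ancestor_property (12 * q + 7) else half_block (12 * q + 6))"

text \<open>The length of the first atom of the block: 8 for \<open>X\<close>, 6 for
  \<open>V\<close>.\<close>

definition mid :: "nat \<Rightarrow> nat" where
  "mid q = (if special q then 8 else 6)"

lemma ends_at_table:
  assumes "2 \<le> q" "q < 8"
  shows "ends_at q (mid q)"
proof -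
  have "q = 2 \<or> q = 3 \<or> q = 4 \<or> q = 5 \<or> q = 6 \<or> q = 7" using assms by auto
  then have "12 * q + r \<in> set end_table \<longleftrightarrow> r = mid q \<or> r = 12" if "r \<in> {1..12}" for r
    using that by (elim disjE) (auto simp: mid_def special_small end_table_def)
  moreover have "ends_atom (12 * q + r) \<longleftrightarrow> 12 * q + r \<in> set end_table" if "r \<in> {1..12}" for r
    using assms that by (intro ends_atom_table) auto
  ultimately show ?thesis
    unfolding ends_at_def by blast
qed

text \<open>The half freed during block \<open>q\<close> is the second half of block
  \<open>q div 2\<close> if \<open>q\<close> is odd and the first half if \<open>q\<close> is even.
  First halves are always normal.\<close>

lemma parent_half_block:
  assumes "4 \<le> q" "block (q div 2)"
  shows "if special q then ancestor_property (6 * q + 1) else half_block (6 * q)"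
proof -
  define p where "p = q div 2"
  note p = assms(2)[unfolded block_def, folded p_def]
  have sp: "special q \<longleftrightarrow> odd q \<and> special p"
    using special_iff assms(1) by (simp add: p_def)
  show ?thesis
  proof (cases "odd q")
    case True
    then have "q = 2 * p + 1" unfolding p_def by simp
    then have eq: "6 * q + 1 = 12 * p + 7" "6 * q = 12 * p + 6" by simp_all
    have "ancestor_property (6 * q + 1)" if "special p" unfolding eq(1) using p that by simp
    moreover have "half_block (6 * q)" if "\<not> special p" unfolding eq(2) using p that by simp
    ultimately show ?thesis using True sp by simp
  next
    case False
    then have "q = 2 * p" unfolding p_def by simp
    then have "6 * q = 12 * p" by simp
    with p False sp show ?thesis by simp
  qed
qed

text \<open>Block \<open>q div 2\<close> supplies the freed half, and block \<open>q - 1\<close>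
  guarantees that an atom ends just before block \<open>q\<close>. The induction starts at 4 because
  the pairs in the second halves of blocks 2 and 3 have no earlier ancestor.\<close>

lemma block_structure: "4 \<le> q \<Longrightarrow> block q \<and> ends_at q (mid q)"
proof (induction q rule: less_induct)
  case (less q)
  show ?case
  proof (cases "q < 8")
    case True
    with less.prems have "q = 4 \<or> q = 5 \<or> q = 6 \<or> q = 7" by auto
    then have "block q"
      unfolding block_def
      by (elim disjE) (simp_all add: special_small half_block_table ancestor_property_67
          ancestor_property_91)
    then show ?thesis using ends_at_table less.prems True by simp
  next
    case False
    then have "block (q div 2)" using less.IH[of "q div 2"] by simp
    note parent = parent_half_block[OF less.prems this]
    have "ends_at (q - 1) (mid (q - 1))" using less.IH[of "q - 1"] False by simp
    then have "ends_atom (12 * (q - 1) + 12)" unfolding ends_at_def by simp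
    moreover have "12 * (q - 1) + 12 = 12 * q" using False by simp
    ultimately have ends: "ends_atom (12 * q)" by simp
    show ?thesis
    proof (cases "special q")
      case True
      with parent have "ancestor_property (6 * q + 1)" by simp
      from special_block_step[OF _ ends this] False True show ?thesis
        unfolding block_def mid_def by simp
    next
      case normal: False
      with parent have "half_block (6 * q)" by simp
      from normal_block_step[OF _ ends this] False normal show ?thesis
        unfolding block_def mid_def by simp
    qed
  qed
qed

lemma ends_at_mid: "2 \<le> q \<Longrightarrow> ends_at q (mid q)"
  using block_structure[of q] ends_at_table[of q] by (cases "q < 8") auto

subsection \<open>Atoms and words\<close>

text \<open>For \<open>q \<ge> 2\<close>, block \<open>q\<close> consists of the atoms \<open>2 q + 1\<close> and \<open>2 q + 2\<close>.\<close>
definition last_index :: "nat \<Rightarrow> nat" where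
  "last_index j = (if j < 4 then [4, 8, 14, 20] ! j
     else if even j then 12 * (j div 2) else 12 * (j div 2) + mid (j div 2))"

text \<open>The two atoms of block \<open>q\<close> have numbers \<open>2 * q + 1\<close> and
  \<open>2 * q + 2\<close>, so an even number belongs to block \<open>j div 2 - 1\<close>.\<close>

definition type_of :: "nat \<Rightarrow> atom_type" where
  "type_of j = (if j < 5 then S_word ! j
     else if odd j then (if special (j div 2) then X else V)
     else (if special (j div 2 - 1) then U else W))"

lemma last_index_even: "2 \<le> q \<Longrightarrow> last_index (2 * q) = 12 * q"
  unfolding last_index_def by simp

lemma last_index_odd: "2 \<le> q \<Longrightarrow> last_index (2 * q + 1) = 12 * q + mid q"
  unfolding last_index_def by simp

lemma mid_bounds: "1 \<le> mid q" "mid q < 12" "mid q \<in> {1..12}"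
  unfolding mid_def by auto

lemma index_cases:
  fixes j :: nat
  obtains "j < 4" | q where "2 \<le> q" "j = 2 * q" | q where "2 \<le> q" "j = 2 * q + 1"
proof (cases "j < 4")
  case False
  then have "2 \<le> j div 2" "j = 2 * (j div 2) \<or> j = 2 * (j div 2) + 1" by auto
  with that show thesis by metis
qed (use that in blast)

section \<open>Enumeration of the ends of atoms\<close>

lemma strict_mono_last_index: "strict_mono last_index"
proof (rule strict_mono_Suc_iff[THEN iffD2], rule allI)
  fix j
  show "last_index j < last_index (Suc j)"
  proof (cases j rule: index_cases)
    case 1
    then have "j = 0 \<or> j = 1 \<or> j = 2 \<or> j = 3" by auto
    then show ?thesis by (auto simp: last_index_def)
  next
    case (2 q)
    then show ?thesis using last_index_even[of q] last_index_odd[of q] mid_bounds[of q] by simp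
  next
    case (3 q)
    then show ?thesis
      using last_index_odd[of q] last_index_even[of "q + 1"] mid_bounds[of q] by simp
  qed
qed

lemma ends_atom_block:
  "2 \<le> q \<Longrightarrow> r \<in> {1..12} \<Longrightarrow> ends_atom (12 * q + r) \<longleftrightarrow> r = mid q \<or> r = 12"
  using ends_at_mid unfolding ends_at_def by blast

lemma range_last_index: "range last_index = {n. ends_atom n}"
proof (intro equalityI subsetI)
  fix n assume "n \<in> range last_index"
  then obtain j where j: "n = last_index j" by blast
  have "ends_atom (last_index j)"
  proof (cases j rule: index_cases)
    case 1
    then have "j = 0 \<or> j = 1 \<or> j = 2 \<or> j = 3" by auto
    then show ?thesis by (auto simp: last_index_def ends_atom_table end_table_def)
  next
    case (2 q)
    show ?thesis
    proof (cases "q = 2")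
      case True
      with 2 show ?thesis by (simp add: last_index_def ends_atom_table end_table_def)
    next
      case False
      with 2 have "2 \<le> q - 1" "12 * q = 12 * (q - 1) + 12" by auto
      with ends_atom_block[of "q - 1" 12] 2 show ?thesis by (simp add: last_index_even)
    qed
  next
    case (3 q)
    with ends_atom_block[of q "mid q"] mid_bounds(3) last_index_odd[of q] show ?thesis by simp
  qed
  with j show "n \<in> {n. ends_atom n}" by simp
next
  fix n assume "n \<in> {n. ends_atom n}"
  then have n: "ends_atom n" by simp
  then have "1 \<le> n" by (simp add: ends_atom_def)
  show "n \<in> range last_index"
  proof (cases "n \<le> 24")
    case True
    with n \<open>1 \<le> n\<close> have "n \<in> {4, 8, 14, 20, 24}"
      by (auto simp: ends_atom_table end_table_def)
    moreover have "last_index 0 = 4" "last_index 1 = 8" "last_index 2 = 14" "last_index 3 = 20"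
      "last_index 4 = 24" by (simp_all add: last_index_def)
    ultimately show ?thesis by (metis empty_iff insert_iff rangeI)
  next
    case False
    \<comment> \<open>Positions within a block run from 1 to 12, hence the shift by 1.\<close>
    define q r where "q = (n - 1) div 12" and "r = (n - 1) mod 12 + 1"
    have qr: "n = 12 * q + r" "2 \<le> q" "r \<in> {1..12}"
      using False unfolding q_def r_def by auto
    with n ends_atom_block have "r = mid q \<or> r = 12" by blast
    then have "n = last_index (2 * q + 1) \<or> n = last_index (2 * (q + 1))"
      using qr last_index_odd[of q] last_index_even[of "q + 1"] by auto
    then show ?thesis by blast
  qed
qed

lemma enumerate_range:
  assumes "strict_mono (f :: nat \<Rightarrow> nat)"
  shows "enumerate (range f) n = f n"
proof (induction n)
  case 0
  show ?case
    unfolding enumerate_0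
    by (rule Least_equality) (auto simp: strict_mono_less_eq[OF assms])
next
  case (Suc n)
  have "infinite (range f)"
    using assms by (intro range_inj_infinite strict_mono_imp_inj_on)
  then have "enumerate (range f) (Suc n) = (LEAST s. s \<in> range f \<and> f n < s)"
    using enumerate_Suc''[of "range f" n] Suc by simp
  also have "\<dots> = f (Suc n)"
    by (rule Least_equality)
      (auto simp: strict_mono_less_eq[OF assms] strict_mono_less[OF assms])
  finally show ?case .
qed

lemma infinite_ends_atom: "infinite {n. ends_atom n}"
  unfolding range_last_index[symmetric]
  using strict_mono_last_index by (intro range_inj_infinite strict_mono_imp_inj_on)

lemma atom_last_eq: "atom_last j = last_index j"
  unfolding atom_last_def range_last_index[symmetric]
  by (rule enumerate_range[OF strict_mono_last_index])

section \<open>Codes and types of atoms\<close>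

lemma step_code_table:
  assumes "i \<in> {1..96}"
  shows "step_code i = A (length (table ! (i - 1))) #
     (if even i then [F (length (table ! (i div 2 - 1)))] else [])"
  using assms unfolding step_code_def by (auto simp: weight_table elim!: evenE)

lemma atom_code_eq:
  "atom_code j = concat (map step_code
     [(if j = 0 then 1 else last_index (j - 1) + 1)..<last_index j + 1])"
  unfolding atom_code_def atom_first_def atom_last_eq ..

text \<open>Atoms 0 to 16 make up exactly the first 96 terms, so their codes can be
  evaluated.\<close>

lemma has_type_table:
  assumes "j < 17"
  shows "has_type j (type_of j)"
proof -
  have "j = 0 \<or> j = 1 \<or> j = 2 \<or> j = 3 \<or> j = 4 \<or> j = 5 \<or> j = 6 \<or> j = 7 \<or> j = 8 \<or> j = 9 \<or>
      j = 10 \<or> j = 11 \<or> j = 12 \<or> j = 13 \<or> j = 14 \<or> j = 15 \<or> j = 16"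
    using assms by presburger
  then show ?thesis
    unfolding has_type_def atom_code_eq
    by (elim disjE)
      (simp_all add: last_index_def type_of_def mid_def special_small S_word_def upt_rec
        step_code_table table_def)
qed

lemma upt_block:
  "[12 * q + 1..<12 * q + 7] =
     [12 * q + 1, 12 * q + 2, 12 * q + 3, 12 * q + 4, 12 * q + 5, 12 * q + 6]"
  "[12 * q + 7..<12 * q + 13] =
     [12 * q + 7, 12 * q + 8, 12 * q + 9, 12 * q + 10, 12 * q + 11, 12 * q + 12]"
  "[12 * q + 1..<12 * q + 9] =
     [12 * q + 1, 12 * q + 2, 12 * q + 3, 12 * q + 4, 12 * q + 5, 12 * q + 6, 12 * q + 7, 12 * q + 8]"
  "[12 * q + 9..<12 * q + 13] = [12 * q + 9, 12 * q + 10, 12 * q + 11, 12 * q + 12]"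
  by (simp_all add: upt_rec)

lemma half_block_weights:
  assumes "half_block k"
  shows "weight (two_up (k + 1)) = 2" "weight (two_up (k + 2)) = 1" "weight (two_up (k + 3)) = 1"
    "weight (two_up (k + 4)) = 1" "weight (two_up (k + 5)) = 2" "weight (two_up (k + 6)) = 1"
  using assms unfolding half_block_def by (auto simp: weight_single weight_pair)

lemma ancestor_property_weights:
  assumes "ancestor_property p"
  shows "weight (two_up p) = 2" "weight (two_up (p + 1)) = 1" "weight (two_up (p + 2)) = 2"
    "weight (two_up (p + 3)) = 1" "weight (two_up (p + 4)) = 1" "weight (two_up (p + 5)) = 1"
  using assms unfolding ancestor_property_def
  by (auto simp: weight_exp weight_exp_add_exp simp del: power_Suc One_nat_def)

text \<open>The \<open>A\<close> weights come from block \<open>q\<close>, the \<open>F\<close>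
  weights from the half block after \<open>6 * q\<close>. The bound 8 places \<open>q div 2\<close>
  in the range of the block invariant.\<close>

lemma has_type_block:
  assumes "8 \<le> q"
  shows "has_type (2 * q + 1) (if special q then X else V)"
    "has_type (2 * q + 2) (if special q then U else W)"
proof -
  have b: "block q" "block (q div 2)"
    using block_structure[of q] block_structure[of "q div 2"] assms by auto
  note * = b(1)[unfolded block_def] and parent = parent_half_block[OF _ b(2)]
  have idx: "12 * q + 6 + 1 = 12 * q + 7" "12 * q + 6 + 2 = 12 * q + 8" "12 * q + 6 + 3 = 12 * q + 9"
    "12 * q + 6 + 4 = 12 * q + 10" "12 * q + 6 + 5 = 12 * q + 11" "12 * q + 6 + 6 = 12 * q + 12"
    "12 * q + 7 + 1 = 12 * q + 8" "12 * q + 7 + 2 = 12 * q + 9" "12 * q + 7 + 3 = 12 * q + 10"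
    "12 * q + 7 + 4 = 12 * q + 11" "12 * q + 7 + 5 = 12 * q + 12"
    "6 * q + 1 + 1 = 6 * q + 2" "6 * q + 1 + 2 = 6 * q + 3" "6 * q + 1 + 3 = 6 * q + 4"
    "6 * q + 1 + 4 = 6 * q + 5" "6 * q + 1 + 5 = 6 * q + 6" "12 * q + 8 + 1 = 12 * q + 9"
    by simp_all
  have odd_idx: "step_code (12 * q + 1) = [A (weight (two_up (12 * q + 1)))]"
    "step_code (12 * q + 3) = [A (weight (two_up (12 * q + 3)))]"
    "step_code (12 * q + 5) = [A (weight (two_up (12 * q + 5)))]"
    "step_code (12 * q + 7) = [A (weight (two_up (12 * q + 7)))]"
    "step_code (12 * q + 9) = [A (weight (two_up (12 * q + 9)))]"
    "step_code (12 * q + 11) = [A (weight (two_up (12 * q + 11)))]"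
    unfolding step_code_def by simp_all
  have even_idx:
    "step_code (12 * q + 2) = [A (weight (two_up (12 * q + 2))), F (weight (two_up (6 * q + 1)))]"
    "step_code (12 * q + 4) = [A (weight (two_up (12 * q + 4))), F (weight (two_up (6 * q + 2)))]"
    "step_code (12 * q + 6) = [A (weight (two_up (12 * q + 6))), F (weight (two_up (6 * q + 3)))]"
    "step_code (12 * q + 8) = [A (weight (two_up (12 * q + 8))), F (weight (two_up (6 * q + 4)))]"
    "step_code (12 * q + 10) = [A (weight (two_up (12 * q + 10))), F (weight (two_up (6 * q + 5)))]"
    "step_code (12 * q + 12) = [A (weight (two_up (12 * q + 12))), F (weight (two_up (6 * q + 6)))]"
    unfolding step_code_def index_half by simp_all
  have last: "last_index (2 * q) = 12 * q" "last_index (2 * q + 1) = 12 * q + mid q"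
    "last_index (2 * q + 2) = 12 * q + 12"
    using last_index_even[of q] last_index_odd[of q] last_index_even[of "q + 1"] assms by auto
  have codes: "atom_code (2 * q + 1) = concat (map step_code [12 * q + 1..<12 * q + mid q + 1])"
    "atom_code (2 * q + 2) = concat (map step_code [12 * q + mid q + 1..<12 * q + 13])"
    using last unfolding atom_code_eq by (simp_all add: ac_simps)
  have "has_type (2 * q + 1) (if special q then X else V) \<and>
    has_type (2 * q + 2) (if special q then U else W)"
  proof (cases "special q")
    case True
    with parent assms have "ancestor_property (6 * q + 1)" by simp
    note w = half_block_weights[of "12 * q"] ancestor_property_weights[of "12 * q + 7", unfolded idx]
      ancestor_property_weights[OF this, unfolded idx]
    show ?thesis
      using True * unfolding has_type_def codes mid_def
      by (simp only: if_True idx upt_block odd_idx even_idx w list.map concat.simps append.simps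
          type_code.simps)
  next
    case False
    with parent assms have "half_block (6 * q)" by simp
    note w = half_block_weights[of "12 * q"] half_block_weights[of "12 * q + 6", unfolded idx]
      half_block_weights[OF this, unfolded idx]
    show ?thesis
      using False * unfolding has_type_def codes mid_def
      by (simp only: if_False idx upt_block odd_idx even_idx w list.map concat.simps append.simps
          type_code.simps)
  qed
  then show "has_type (2 * q + 1) (if special q then X else V)"
    "has_type (2 * q + 2) (if special q then U else W)" by auto
qed

lemma has_type_type_of: "has_type j (type_of j)"
proof (cases "j < 17")
  case False
  define q where "q = (j - 1) div 2"
  have "8 \<le> q" "j = 2 * q + 1 \<or> j = 2 * q + 2" using False unfolding q_def by auto
  with has_type_block[of q] show ?thesis unfolding type_of_def by auto
qed (rule has_type_table)

section \<open>The infinite word as a sequence of block words\<close>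

definition block_word :: "nat \<Rightarrow> atom_type list" where
  "block_word q = (if special q then [X, U] else [V, W])"

lemma type_word:
  "map type_of [0..<5 + 2 * m] = S_word @ concat (map block_word [2..<2 + m])"
proof (induction m)
  case 0
  show ?case by (simp add: type_of_def S_word_def upt_rec)
next
  case (Suc m)
  have "[0..<5 + 2 * Suc m] = [0..<Suc (Suc (5 + 2 * m))]" by simp
  also have "\<dots> = [0..<5 + 2 * m] @ [5 + 2 * m, Suc (5 + 2 * m)]"
    by (simp only: upt_Suc zero_le if_True append_assoc append.simps)
  finally have "[0..<5 + 2 * Suc m] = [0..<5 + 2 * m] @ [5 + 2 * m, Suc (5 + 2 * m)]" .
  moreover have "[2..<2 + Suc m] = [2..<2 + m] @ [2 + m]" by simp
  moreover have "(5 + 2 * m) div 2 = 2 + m" "Suc (5 + 2 * m) div 2 - 1 = 2 + m" by auto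
  then have "map type_of [5 + 2 * m, Suc (5 + 2 * m)] = block_word (2 + m)"
    by (simp add: type_of_def block_word_def)
  ultimately show ?case using Suc.IH by simp
qed

text \<open>In this range of blocks, exactly the last block of each half is special, which accounts
  for the two runs of normal blocks, each followed by \<open>X\<close>, \<open>U\<close>.\<close>

lemma R_word_eq: "R_word (Suc n) = concat (map block_word [2 * 2 ^ n..<4 * 2 ^ n])"
proof -
  define N :: nat where "N = 2 ^ n"
  have N: "1 \<le> N" by (simp add: N_def)
  have sp: "special q \<longleftrightarrow> q + 1 = 3 * N \<or> q + 1 = 4 * N" if "2 * N \<le> q" "q < 4 * N" for q
    using special_range that unfolding N_def by blast
  have run: "map block_word [a..<a + (N - 1)] = replicate (N - 1) [V, W]"
    if "a = 2 * N \<or> a = 3 * N" for a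
    using sp that by (intro nth_equalityI) (auto simp: block_word_def)
  have top: "block_word (2 * N + (N - 1)) = [X, U]" "block_word (3 * N + (N - 1)) = [X, U]"
    using sp[of "2 * N + (N - 1)"] sp[of "3 * N + (N - 1)"] N by (auto simp: block_word_def)
  have s: "3 * N = Suc (2 * N + (N - 1))" "4 * N = Suc (3 * N + (N - 1))" using N by simp_all
  have "[2 * N..<4 * N] = [2 * N..<3 * N] @ [3 * N..<4 * N]"
    using upt_add_eq_append[of "2 * N" "3 * N" N] by simp
  also have "[2 * N..<3 * N] = [2 * N..<2 * N + (N - 1)] @ [2 * N + (N - 1)]"
    unfolding s(1) by (simp only: upt_Suc le_add1 if_True)
  also have "[3 * N..<4 * N] = [3 * N..<3 * N + (N - 1)] @ [3 * N + (N - 1)]"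
    unfolding s(2) by (simp only: upt_Suc le_add1 if_True)
  finally have split: "[2 * N..<4 * N] = ([2 * N..<2 * N + (N - 1)] @ [2 * N + (N - 1)]) @
      ([3 * N..<3 * N + (N - 1)] @ [3 * N + (N - 1)])" .
  show ?thesis
    unfolding R_word_def diff_Suc_1 N_def[symmetric] split map_append list.map top
      run[OF disjI1[OF refl]] run[OF disjI2[OF refl]] by simp
qed

lemma SR_word_eq: "SR_word k = S_word @ concat (map block_word [2..<2 * 2 ^ k])"
proof (induction k)
  case 0
  show ?case by (simp add: SR_word_def)
next
  case (Suc k)
  have "(1 :: nat) \<le> 2 ^ k" by simp
  then have "[2..<4 * 2 ^ k] = [2..<2 * 2 ^ k] @ [2 * 2 ^ k..<4 * 2 ^ k :: nat]"
    using upt_add_eq_append[of 2 "2 * 2 ^ k" "2 * 2 ^ k"] by simp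
  moreover have "SR_word (Suc k) = SR_word k @ R_word (Suc k)"
    by (simp add: SR_word_def)
  ultimately show ?case using Suc R_word_eq[of k] by simp
qed

text \<open>The five letters of \<open>S_word\<close> and two letters for each of the
  \<open>2 * 2 ^ k - 2\<close> blocks add up to \<open>1 + 4 * 2 ^ k\<close>.\<close>

lemma SR_word_prefix: "SR_word k = map type_of [0..<1 + 4 * 2 ^ k]"
proof -
  have "(1 :: nat) \<le> 2 ^ k" by simp
  then have "5 + 2 * (2 * 2 ^ k - 2) = 1 + 4 * (2 :: nat) ^ k" "2 + (2 * 2 ^ k - 2) = 2 * (2 :: nat) ^ k"
    by arith+
  with type_word[of "2 * 2 ^ k - 2"] SR_word_eq[of k] show ?thesis by metis
qed

lemma word_limit_SR_word: "word_limit SR_word type_of"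
  unfolding word_limit_def
proof
  fix n
  show "\<forall>\<^sub>F k in sequentially.
      n \<le> length (SR_word k) \<and> take n (SR_word k) = map type_of [0..<n]"
    using eventually_ge_at_top[of n]
  proof eventually_elim
    case (elim k)
    then have "n \<le> 1 + 4 * 2 ^ k" using less_exp[of k] by linarith
    then show ?case by (simp add: SR_word_prefix take_map take_upt del: upt_Suc)
  qed
qed

text \<open>An atom has at most one type, so an atom found to have type \<open>X\<close> must have
  \<open>X\<close> as its value of \<open>type_of\<close>.\<close>

lemma type_code_inj: "type_code \<sigma> = type_code \<tau> \<Longrightarrow> \<sigma> = \<tau>"
  by (cases \<sigma>; cases \<tau>) simp_all

theorem theorem4p1:
  shows "infinite {n. ends_atom n} \<and>
    (\<exists>\<tau> :: nat \<Rightarrow> atom_type. (\<forall>j. has_type j (\<tau> j)) \<and> word_limit SR_word \<tau>) \<and>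
    (\<forall>k\<ge>2. \<forall>j. length (SR_word (k - 1)) \<le> j \<and> j + 1 < length (SR_word k) \<and>
        has_type j X \<and> has_type (j + 1) U \<longrightarrow>
      (\<exists>p. p + 1 = atom_last j \<and> p + 5 = atom_last (j + 1) \<and> ancestor_property p))"
proof (intro conjI allI impI)
  show "\<exists>\<tau>. (\<forall>j. has_type j (\<tau> j)) \<and> word_limit SR_word \<tau>"
    using has_type_type_of word_limit_SR_word by blast
next
  fix k j :: nat
  assume k: "2 \<le> k"
    and j: "length (SR_word (k - 1)) \<le> j \<and> j + 1 < length (SR_word k) \<and>
        has_type j X \<and> has_type (j + 1) U"
  \<comment> \<open>S R(1) has nine letters, so the atom lies in block 4 or later, where the block
    invariant holds.\<close>
  have "(2 :: nat) ^ 1 \<le> 2 ^ (k - 1)" using k by (intro power_increasing) auto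
  with j have "9 \<le> j" by (simp add: SR_word_prefix)
  have "type_of j = X"
    using j has_type_type_of[of j] type_code_inj unfolding has_type_def by metis
  with \<open>9 \<le> j\<close> have "odd j" "special (j div 2)"
    unfolding type_of_def by (auto split: if_splits)
  then obtain q where q: "j = 2 * q + 1" "special q" "4 \<le> q"
    using \<open>9 \<le> j\<close> by (auto elim!: oddE)
  have "ancestor_property (12 * q + 7)"
    using block_structure[of q] q unfolding block_def by simp
  moreover have "atom_last j = 12 * q + 8" "atom_last (j + 1) = 12 * q + 12"
    using last_index_odd[of q] last_index_even[of "q + 1"] q
    unfolding atom_last_eq mid_def by auto
  ultimately show "\<exists>p. p + 1 = atom_last j \<and> p + 5 = atom_last (j + 1) \<and> ancestor_property p"
    by (intro exI[of _ "12 * q + 7"]) simp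
qed (rule infinite_ends_atom)

end
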